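(* Let $q$ be a positive real number. The $q$-Vilenkin functions $P^J_{MNq}(\xi)$ satisfy the orthonormality relation $$\begin{aligned}\frac{q-q^{-1}}{4\ln q}\int_{-1}^{+1}d\xi\,\Biggl(&\overline{P^{J'}_{MNq^{-1}}(\xi)}\,\frac{1}{q+q^{-1}-(q-q^{-1})\xi}\,q^{(\xi^2-1)\partial_\xi}P^J_{MNq}(\xi)\\&+\overline{P^{J'}_{MNq}(\xi)}\,\frac{1}{q+q^{-1}+(q-q^{-1})\xi}\,q^{-(\xi^2-1)\partial_\xi}P^J_{MNq^{-1}}(\xi)\Biggr)=\frac{\delta_{J',J}}{[2J+1]_q},\end{aligned}$$ where $J,J',M,N$ are simultaneously integers or half-odd-integers, with $|M|,|N|\le J$ and $|M|,|N|\le J'$.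
   Context: Notation: $[x]_q=\frac{q^x-q^{-x}}{q-q^{-1}}$ (equal to $x$ at $q=1$); $[x]_q!=[x]_q[x-1]_q\cdots[1]_q$ for positive integers $x$, $[0]_q!=1$. At $q=1$, $\frac{q-q^{-1}}{\ln q}$ is read as its limit $2$. The $q$-Vilenkin functions are, for $-1<\xi<1$ and $\eta=\frac{1+\xi}{1-\xi}$, $$P^J_{MNq}(\xi)=i^{2J-M-N}\left(\frac{[J+M]_q!\,[J+N]_q!}{[J-M]_q!\,[J-N]_q!}\right)^{1/2}\eta^{(M+N)/2}\,Q_{Jq}(\eta)\,R^J_{MNq}(\eta),$$ $$R^J_{MNq}(\eta)=[J-N]_q!\,[J-M]_q!\sum_k\frac{(-\eta)^k}{[k]_q!\,[J-M-k]_q!\,[J-N-k]_q!\,[M+N+k]_q!}$$ (sum over integers $k$ for which all factorial arguments are nonnegative), and $$Q_{Jq}(\eta)=\prod_{k=0}^\infty\frac{1+q^{2k}\eta}{1+q^{-2J+2k}\eta}\ (0<q<1),\qquad Q_{Jq}(\eta)=\prod_{k=0}^\infty\frac{1+q^{-2J-2k-2}\eta}{1+q^{-2k-2}\eta}\ (q>1),$$ with limiting value $Q_{J1}(\eta)=(1+\eta)^{-J}$ at $q=1$. (For integer $J$, $Q_{Jq}(\eta)=\prod_{k=0}^{J-1}(1+\eta q^{-2J+2k})^{-1}$.) $P^J_{MNq^{-1}}$ is obtained by replacing $q$ by $q^{-1}$. Since $(\xi^2-1)\partial_\xi=-2\eta\partial_\eta$, the operator $q^{\pm(\xi^2-1)\partial_\xi}$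 acts on a function of $\xi$ by replacing $\eta$ by $q^{\mp2}\eta$ (so $\eta^{(M+N)/2}$ becomes $q^{\mp(M+N)}\eta^{(M+N)/2}$). *)

theory Defs
  imports "HOL-Analysis.Analysis"
begin

text \<open>Throughout, \<open>q > 0\<close> is real, and the parameters \<open>J\<close>, \<open>M\<close>, \<open>N\<close> are real numbers that are
  simultaneously integers or half-odd-integers, so that \<open>J \<plusminus> M\<close>, \<open>J \<plusminus> N\<close>, \<open>M + N\<close> and \<open>2 * J\<close>
  are integers.\<close>

definition qnum :: "real \<Rightarrow> real \<Rightarrow> real" where
  "qnum q x = (if q = 1 then x else (q powr x - q powr (- x)) / (q - inverse q))"

text \<open>Only meaningful when \<open>x\<close> is a nonnegative integer.\<close>

definition qfact :: "real \<Rightarrow> real \<Rightarrow> real" where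
  "qfact q x = (\<Prod>k = 1..nat \<lfloor>x\<rfloor>. qnum q (real k))"

text \<open>\<open>(q - q\<^sup>-\<^sup>1) / ln q\<close>, with its limiting value at \<open>q = 1\<close>.\<close>

definition qlog_ratio :: "real \<Rightarrow> real" where
  "qlog_ratio q = (if q = 1 then 2 else (q - inverse q) / ln q)"

definition eta_of :: "real \<Rightarrow> real" where
  "eta_of \<xi> = (1 + \<xi>) / (1 - \<xi>)"

text \<open>Inverse of \<^const>\<open>eta_of\<close>, which maps the open interval from \<open>-1\<close> to \<open>1\<close> onto the positive
  reals.\<close>

definition xi_of :: "real \<Rightarrow> real" where
  "xi_of \<eta> = (\<eta> - 1) / (\<eta> + 1)"

definition vilenkin_Q :: "real \<Rightarrow> real \<Rightarrow> real \<Rightarrow> real" where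
  "vilenkin_Q q J \<eta> =
    (if q < 1 then
       (\<Prod>k. (1 + q powr (2 * real k) * \<eta>) / (1 + q powr (- 2 * J + 2 * real k) * \<eta>))
     else if q = 1 then (1 + \<eta>) powr (- J)
     else
       (\<Prod>k. (1 + q powr (- 2 * J - 2 * real k - 2) * \<eta>) / (1 + q powr (- 2 * real k - 2) * \<eta>)))"

definition vilenkin_R :: "real \<Rightarrow> real \<Rightarrow> real \<Rightarrow> real \<Rightarrow> real \<Rightarrow> real" where
  "vilenkin_R q J M N \<eta> = qfact q (J - N) * qfact q (J - M) *
    (\<Sum>k \<in> {k::int. 0 \<le> k \<and> 0 \<le> J - M - of_int k \<and> 0 \<le> J - N - of_int k \<and> 0 \<le> M + N + of_int k}.
       (- \<eta>) powi k /
       (qfact q (of_int k) * qfact q (J - M - of_int k) * qfact q (J - N - of_int k) *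
        qfact q (M + N + of_int k)))"

definition vilenkin_P :: "real \<Rightarrow> real \<Rightarrow> real \<Rightarrow> real \<Rightarrow> real \<Rightarrow> complex" where
  "vilenkin_P q J M N \<xi> =
     \<i> powi \<lfloor>2 * J - M - N\<rfloor> *
     complex_of_real
       (sqrt ((qfact q (J + M) * qfact q (J + N)) / (qfact q (J - M) * qfact q (J - N))) *
        eta_of \<xi> powr ((M + N) / 2) * vilenkin_Q q J (eta_of \<xi>) * vilenkin_R q J M N (eta_of \<xi>))"

text \<open>The operator \<open>q\<close> to the power \<open>s (\<xi>\<^sup>2 - 1) \<partial>\<^sub>\<xi>\<close>. Since
  \<open>(\<xi>\<^sup>2 - 1) \<partial>\<^sub>\<xi> = - 2 \<eta> \<partial>\<^sub>\<eta>\<close>, it rescales \<open>\<eta>\<close> by the factor \<open>q\<close> to the power \<open>- 2 s\<close>.\<close>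

definition qshift :: "real \<Rightarrow> real \<Rightarrow> (real \<Rightarrow> complex) \<Rightarrow> real \<Rightarrow> complex" where
  "qshift q s f \<xi> = f (xi_of (q powr (- 2 * s) * eta_of \<xi>))"

end

theory Submission
  imports Defs "HOL-Real_Asymp.Real_Asymp"
begin

text \<open>Put \<open>n = J + J' + 1\<close> and \<open>s = q\<^bsup>J' - J - 1\<^esup> \<eta>\<close>. The infinite products of the two
  factors telescope against each other, and each of the two terms of the integrand becomes a polynomial
  in \<open>s\<close> divided by \<open>w\<^sub>n(s)\<close>, the product of the factors \<open>1 + q\<^bsup>2k - n\<^esup> s\<close> over \<open>k \<le> n\<close>. Its moments
  over the positive reals are \<open>[a]! [n - a - 1]! / [n]!\<close> up to a constant factor: they satisfy
  first-order recurrences because both \<open>w\<^sub>n(q s)\<close> and \<open>w\<^sub>n(s / q)\<close> divide \<open>w\<^sub>n\<^sub>+\<^sub>1(s)\<close>.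
  In the resulting double sum, the inner sum is an alternating \<open>q\<close>-binomial sum of a product of \<open>J - M\<close>
  \<open>q\<close>-numbers linear in the summation index. For \<open>J < J'\<close> there are too few factors, so it vanishes;
  for \<open>J = J'\<close> only the top coefficient survives, and the outer sum is a \<open>q\<close>-Vandermonde sum.
  The second term of the integrand arises from the first by replacing \<open>q\<close> with \<open>q\<^sup>-\<^sup>1\<close>, which exchanges
  the roles of \<open>J\<close> and \<open>J'\<close> in the double sum. The symmetries of the functions in \<open>M\<close> and \<open>N\<close> reduce
  everything to \<open>0 \<le> M + N\<close> and \<open>N \<le> M\<close>, and then \<open>a = J - M\<close>, \<open>b = J - N\<close>, \<open>c = M + N\<close>,
  \<open>a' = J' - M\<close>, \<open>b' = J' - N\<close> are natural numbers.\<close>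

subsection \<open>\<open>q\<close>-binomial sums\<close>

lemma qnum_add:
  assumes "q > 0"
  shows "qnum q (x + y) = q powr y * qnum q x + q powr (- x) * qnum q y"
proof (cases "q = 1")
  case False
  have "q powr y * (q powr x - q powr (- x)) + q powr (- x) * (q powr y - q powr (- y)) =
      q powr (x + y) - q powr (- (x + y))"
    by (simp add: algebra_simps flip: powr_add)
  then show ?thesis
    using False by (simp add: qnum_def flip: add_divide_distrib)
qed (simp add: qnum_def)

lemma qnum_minus: "qnum q (- x) = - qnum q x"
  by (simp add: qnum_def minus_divide_left)

lemma qnum_0 [simp]: "qnum q 0 = 0"
  by (simp add: qnum_def)

lemma qnum_pos:
  assumes "q > 0" "x > 0"
  shows "qnum q x > 0"
proof -
  consider "q = 1" | "q > 1" | "q < 1" by linarith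
  then show ?thesis
  proof cases
    case 1 then show ?thesis using assms by (simp add: qnum_def)
  next
    case 2
    then have "q powr (- x) < q powr x"
      using assms by (intro powr_less_mono) auto
    moreover have "inverse q < q"
      using 2 by (meson inverse_less_1_iff less_trans)
    ultimately have "q powr (- x) < q powr x" "inverse q < q" .
    then show ?thesis using 2 by (simp add: qnum_def)
  next
    case 3
    then have "q powr (- x) > q powr x"
      using assms by (intro powr_less_mono') auto
    moreover have "inverse q > q"
      using 3 assms one_less_inverse[of q] by linarith
    ultimately have "q powr (- x) > q powr x" "inverse q > q" .
    then show ?thesis using 3 by (simp add: qnum_def divide_neg_neg)
  qed
qed

text \<open>Numerator and denominator both change sign under inversion. Hence q-factorials are the
  same for \<open>q\<close> and \<open>inverse q\<close>, and in the double sum only the explicit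
  powers of \<open>q\<close> change.\<close>

lemma qnum_inverse:
  assumes "q > 0"
  shows "qnum (inverse q) x = qnum q x"
proof -
  have "inverse q powr x = q powr (- x)" for x
    using assms by (simp add: powr_minus inverse_powr)
  moreover have "(q powr (- x) - q powr x) / (inverse q - q) = (q powr x - q powr (- x)) / (q - inverse q)"
    by (metis minus_diff_eq minus_divide_divide)
  ultimately show ?thesis
    by (simp add: qnum_def)
qed

definition qfac :: "real \<Rightarrow> nat \<Rightarrow> real" where
  "qfac q n = (\<Prod>k = 1..n. qnum q (real k))"

lemma qfact_real: "qfact q (real n) = qfac q n"
  by (simp add: qfact_def qfac_def)

lemma qfac_0 [simp]: "qfac q 0 = 1"
  by (simp add: qfac_def)

lemma qfac_Suc: "qfac q (Suc n) = qfac q n * qnum q (real (Suc n))"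
  by (simp add: qfac_def)

lemma qfac_pos: "q > 0 \<Longrightarrow> qfac q n > 0"
  unfolding qfac_def by (intro prod_pos) (auto intro: qnum_pos)

lemma qfac_nonzero [simp]: "q > 0 \<Longrightarrow> qfac q n \<noteq> 0"
  using qfac_pos[of q n] by simp

lemma qfac_inverse: "q > 0 \<Longrightarrow> qfac (inverse q) n = qfac q n"
  by (simp add: qfac_def qnum_inverse)

lemma qfac_add: "qfac q (n + l) = qfac q n * (\<Prod>i = 1..l. qnum q (real n + real i))"
proof (induction l)
  case (Suc l)
  then show ?case
    using qfac_Suc[of q "n + l"] by (simp add: mult.assoc add_ac)
qed simp

section \<open>Alternating q-binomial sums\<close>

lemma sum_qnum_left:
  assumes "q > 0"
  shows "(\<Sum>k\<le>Suc n. qnum q (real k) * g k / (qfac q k * qfac q (Suc n - k))) =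
    (\<Sum>k\<le>n. g (Suc k) / (qfac q k * qfac q (n - k)))"
proof -
  have "qnum q (real (Suc k)) * g (Suc k) / (qfac q (Suc k) * qfac q (n - k)) =
      g (Suc k) / (qfac q k * qfac q (n - k))" for k
    using qnum_pos[OF assms, of "real (Suc k)"] by (simp add: qfac_Suc)
  \<comment> \<open>The term k = 0 vanishes with [0] = 0, so the sum starts at 1 and its index can
    be shifted.\<close>
  then show ?thesis
    by (simp add: sum.atMost_Suc_shift del: of_nat_Suc sum.atMost_Suc)
qed

text \<open>Mirror image of \<open>sum_qnum_left\<close>: the factor kills the top term and cancels
  against the second factorial, so the index stays in place. Together the two lemmas act as Pascal's
  rule.\<close>

lemma sum_qnum_right:
  assumes "q > 0"
  shows "(\<Sum>k\<le>Suc n. qnum q (real (Suc n) - real k) * g k / (qfac q k * qfac q (Suc n - k))) =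
    (\<Sum>k\<le>n. g k / (qfac q k * qfac q (n - k)))"
proof -
  have "qnum q (real (Suc n) - real k) * g k / (qfac q k * qfac q (Suc n - k)) =
      g k / (qfac q k * qfac q (n - k))" if "k \<le> n" for k
  proof -
    have "real (Suc n) - real k = real (Suc (n - k))" "Suc n - k = Suc (n - k)"
      using that by auto
    then show ?thesis
      using qnum_pos[OF assms, of "real (Suc (n - k))"] by (simp add: qfac_Suc del: of_nat_Suc)
  qed
  then show ?thesis by simp
qed

text \<open>A q-analogue of the vanishing alternating sum of a binomial row. After multiplication by
  [n+1], writing n+1 as k + (n+1-k) in the addition formula produces two sums over the previous row,
  which cancel term by term.\<close>

lemma sum_alternating_qbinomial:
  assumes "q > 0"
  shows "(\<Sum>k\<le>Suc n. (- 1) ^ k * q powr (- real k * real n) / (qfac q k * qfac q (Suc n - k))) = 0"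
    (is "?S = 0")
proof -
  let ?g = "\<lambda>k. (- 1) ^ k * q powr (- real k * real n)"
  have "qnum q (real (Suc n)) * ?S =
    (\<Sum>k\<le>Suc n. qnum q (real k) * (q powr (real (Suc n) - real k) * ?g k) / (qfac q k * qfac q (Suc n - k))
       + qnum q (real (Suc n) - real k) * (q powr (- real k) * ?g k) / (qfac q k * qfac q (Suc n - k)))"
    unfolding sum_distrib_left
  proof (rule sum.cong[OF refl])
    fix k
    have *: "qnum q (real (Suc n)) = q powr (real (Suc n) - real k) * qnum q (real k) +
        q powr (- real k) * qnum q (real (Suc n) - real k)"
      using qnum_add[OF assms, of "real k" "real (Suc n) - real k"] by simp
    show "qnum q (real (Suc n)) * (?g k / (qfac q k * qfac q (Suc n - k))) =
      qnum q (real k) * (q powr (real (Suc n) - real k) * ?g k) / (qfac q k * qfac q (Suc n - k))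
       + qnum q (real (Suc n) - real k) * (q powr (- real k) * ?g k) / (qfac q k * qfac q (Suc n - k))"
      unfolding * by (simp add: add_divide_distrib distrib_right distrib_left mult_ac del: of_nat_Suc)
  qed
  also have "\<dots> =
    (\<Sum>k\<le>n. q powr (real (Suc n) - real (Suc k)) * ?g (Suc k) / (qfac q k * qfac q (n - k))) +
    (\<Sum>k\<le>n. q powr (- real k) * ?g k / (qfac q k * qfac q (n - k)))"
    unfolding sum.distrib by (simp only: sum_qnum_left[OF assms] sum_qnum_right[OF assms])
  also have "\<dots> = 0"
    unfolding sum.distrib[symmetric]
  proof (intro sum.neutral ballI)
    fix k
    have "q powr (real (Suc n) - real (Suc k)) * q powr (- real (Suc k) * real n) =
      q powr (- real k) * q powr (- real k * real n)"
      unfolding powr_add[symmetric] by (simp add: algebra_simps)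
    then have "q powr (real (Suc n) - real (Suc k)) * ?g (Suc k) = - (q powr (- real k) * ?g k)"
      by (simp add: mult_ac)
    then show "q powr (real (Suc n) - real (Suc k)) * ?g (Suc k) / (qfac q k * qfac q (n - k)) +
      q powr (- real k) * ?g k / (qfac q k * qfac q (n - k)) = 0"
      by (simp del: of_nat_Suc)
  qed
  finally show ?thesis
    using qnum_pos[OF assms, of "real (Suc n)"] by simp
qed

text \<open>For \<open>q\<close> other than 1, a product of l + m q-numbers linear in k is a
  combination of powers q^(kj) with j = -(l+m), -(l+m)+2, ..., l+m. The extra power moves these to
  q^(ke) with e from 1-n to 1-n+2(l+m) in steps of two, and the alternating q-binomial sum of q^(ke)
  vanishes for e = 1-n, 3-n, ..., n-1. So nothing survives for l + m < n, and only the top power for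
  l + m = n.\<close>

definition qalt_sum :: "real \<Rightarrow> nat \<Rightarrow> nat \<Rightarrow> nat \<Rightarrow> real \<Rightarrow> real \<Rightarrow> real" where
  "qalt_sum q n l m c b = (\<Sum>k\<le>n. ((- 1) ^ k * q powr (real k * (1 - real n + real l + real m)) *
      (\<Prod>i = 1..l. qnum q (c + real k + real i)) * (\<Prod>i = 1..m. qnum q (b - real k + real i))) /
      (qfac q k * qfac q (n - k)))"

text \<open>Both recurrences split the last factor of a product by the addition formula for \<open>q\<close>-numbers: one
  part lowers the power of \<open>q\<^sup>k\<close>, the other cancels against the \<open>q\<close>-factorial of \<open>k\<close>.\<close>

lemma qalt_sum_left:
  assumes "q > 0"
  shows "qalt_sum q (Suc n) (Suc l) m c b =
    qnum q (c + real (Suc l)) * qalt_sum q (Suc n) l m c b -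
    q powr (c + real (Suc l) + 1 - real n + real l + real m) * qalt_sum q n l m (c + 1) (b - 1)"
proof -
  define e where "e = 1 - real n + real l + real m"
  have E: "1 - real (Suc n) + real l + real m = e - 1"
    by (simp add: e_def)
  let ?P = "\<lambda>k. (\<Prod>i = 1..l. qnum q (c + real k + real i))"
  let ?R = "\<lambda>k. (\<Prod>i = 1..m. qnum q (b - real k + real i))"
  let ?D = "\<lambda>k. qfac q k * qfac q (Suc n - k)"
  let ?h = "\<lambda>k. (- 1) ^ k * q powr (real k * e) * ?P k * ?R k"
  have "qalt_sum q (Suc n) (Suc l) m c b =
    (\<Sum>k\<le>Suc n. qnum q (real k) * (q powr (c + real (Suc l)) * ?h k) / ?D k +
      qnum q (c + real (Suc l)) * ((- 1) ^ k * q powr (real k * (e - 1)) * ?P k * ?R k / ?D k))"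
    unfolding qalt_sum_def
  proof (rule sum.cong[OF refl])
    fix k
    have 1: "qnum q (c + real k + real (Suc l)) = q powr (c + real (Suc l)) * qnum q (real k) +
        q powr (- real k) * qnum q (c + real (Suc l))"
      using qnum_add[OF assms, of "real k" "c + real (Suc l)"] by (simp add: add_ac)
    have 2: "q powr (real k * (e - 1)) = q powr (real k * e) * q powr (- real k)"
      unfolding powr_add[symmetric] by (simp add: algebra_simps)
    have 3: "1 - real (Suc n) + real (Suc l) + real m = e"
      by (simp add: e_def)
    have 4: "(\<Prod>i = 1..Suc l. qnum q (c + real k + real i)) = ?P k * qnum q (c + real k + real (Suc l))"
      by simp
    show "(- 1) ^ k * q powr (real k * (1 - real (Suc n) + real (Suc l) + real m)) *
      (\<Prod>i = 1..Suc l. qnum q (c + real k + real i)) * ?R k / ?D k =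
      qnum q (real k) * (q powr (c + real (Suc l)) * ?h k) / ?D k +
      qnum q (c + real (Suc l)) * ((- 1) ^ k * q powr (real k * (e - 1)) * ?P k * ?R k / ?D k)"
      unfolding 3 4 1 2 by (simp add: add_divide_distrib distrib_left distrib_right mult_ac del: of_nat_Suc)
  qed
  also have "\<dots> = (\<Sum>k\<le>n. q powr (c + real (Suc l)) * ?h (Suc k) / (qfac q k * qfac q (n - k))) +
      qnum q (c + real (Suc l)) * qalt_sum q (Suc n) l m c b"
    unfolding sum.distrib sum_qnum_left[OF assms] sum_distrib_left[symmetric] qalt_sum_def E ..
  \<comment> \<open>The shift turns c into c + 1 and b into b - 1, and the shifted power of -1 gives
    the minus sign. The exponent \<open>e\<close> is already the one that \<open>qalt_sum\<close>
    attaches to n, l, m.\<close>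
  also have "(\<Sum>k\<le>n. q powr (c + real (Suc l)) * ?h (Suc k) / (qfac q k * qfac q (n - k))) =
    - (q powr (c + real (Suc l) + e) * qalt_sum q n l m (c + 1) (b - 1))"
    unfolding qalt_sum_def sum_distrib_left sum_negf[symmetric]
  proof (rule sum.cong[OF refl])
    fix k
    have 1: "q powr (real (Suc k) * e) = q powr (real k * e) * q powr e"
      unfolding powr_add[symmetric] by (simp add: algebra_simps)
    have 2: "q powr (c + real (Suc l) + e) = q powr (c + real (Suc l)) * q powr e"
      unfolding powr_add[symmetric] by simp
    have 3: "c + real (Suc k) = c + 1 + real k" "b - real (Suc k) = b - 1 - real k"
      by auto
    show "q powr (c + real (Suc l)) * ?h (Suc k) / (qfac q k * qfac q (n - k)) =
      - (q powr (c + real (Suc l) + e) * ((- 1) ^ k *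
         q powr (real k * (1 - real n + real l + real m)) *
         (\<Prod>i = 1..l. qnum q (c + 1 + real k + real i)) *
         (\<Prod>i = 1..m. qnum q (b - 1 - real k + real i)) / (qfac q k * qfac q (n - k))))"
      unfolding 1 2 3 e_def[symmetric] by (simp add: mult_ac)
  qed
  finally show ?thesis
    by (simp add: e_def algebra_simps)
qed

lemma qalt_sum_right:
  assumes "q > 0"
  shows "qalt_sum q (Suc n) l (Suc m) c b =
    qnum q (b + real (Suc m)) * qalt_sum q (Suc n) l m c b +
    q powr (- b - real (Suc m) + 1 - real n + real l + real m) * qalt_sum q n l m (c + 1) (b - 1)"
proof -
  define e where "e = 1 - real n + real l + real m"
  have E: "1 - real (Suc n) + real l + real m = e - 1"
    by (simp add: e_def)
  let ?P = "\<lambda>k. (\<Prod>i = 1..l. qnum q (c + real k + real i))"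
  let ?R = "\<lambda>k. (\<Prod>i = 1..m. qnum q (b - real k + real i))"
  let ?D = "\<lambda>k. qfac q k * qfac q (Suc n - k)"
  let ?h = "\<lambda>k. (- 1) ^ k * q powr (real k * e) * ?P k * ?R k"
  have "qalt_sum q (Suc n) l (Suc m) c b =
    (\<Sum>k\<le>Suc n. qnum q (real k) * (- (q powr (- b - real (Suc m))) * ?h k) / ?D k +
      qnum q (b + real (Suc m)) * ((- 1) ^ k * q powr (real k * (e - 1)) * ?P k * ?R k / ?D k))"
    unfolding qalt_sum_def
  proof (rule sum.cong[OF refl])
    fix k
    \<comment> \<open>Here [k] enters with a minus sign, which cancels the sign of the later index
      shift; hence the plus in this recurrence, against the minus in
      \<open>qalt_sum_left\<close>.\<close>
    have 1: "qnum q (b - real k + real (Suc m)) = q powr (- real k) * qnum q (b + real (Suc m)) -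
        q powr (- b - real (Suc m)) * qnum q (real k)"
      using qnum_add[OF assms, of "b + real (Suc m)" "- real k"]
      by (simp add: qnum_minus diff_add_eq del: of_nat_Suc)
    have 2: "q powr (real k * (e - 1)) = q powr (real k * e) * q powr (- real k)"
      unfolding powr_add[symmetric] by (simp add: algebra_simps)
    have 3: "1 - real (Suc n) + real l + real (Suc m) = e"
      by (simp add: e_def)
    have 4: "(\<Prod>i = 1..Suc m. qnum q (b - real k + real i)) = ?R k * qnum q (b - real k + real (Suc m))"
      by simp
    show "(- 1) ^ k * q powr (real k * (1 - real (Suc n) + real l + real (Suc m))) *
      ?P k * (\<Prod>i = 1..Suc m. qnum q (b - real k + real i)) / ?D k =
      qnum q (real k) * (- (q powr (- b - real (Suc m))) * ?h k) / ?D k +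
      qnum q (b + real (Suc m)) * ((- 1) ^ k * q powr (real k * (e - 1)) * ?P k * ?R k / ?D k)"
      unfolding 3 4 1 2
      by (simp add: diff_divide_distrib right_diff_distrib left_diff_distrib mult_ac del: of_nat_Suc)
  qed
  also have "\<dots> = (\<Sum>k\<le>n. - (q powr (- b - real (Suc m))) * ?h (Suc k) / (qfac q k * qfac q (n - k))) +
      qnum q (b + real (Suc m)) * qalt_sum q (Suc n) l m c b"
    unfolding sum.distrib sum_qnum_left[OF assms] sum_distrib_left[symmetric] qalt_sum_def E ..
  also have "(\<Sum>k\<le>n. - (q powr (- b - real (Suc m))) * ?h (Suc k) / (qfac q k * qfac q (n - k))) =
    q powr (- b - real (Suc m) + e) * qalt_sum q n l m (c + 1) (b - 1)"
    unfolding qalt_sum_def sum_distrib_left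
  proof (rule sum.cong[OF refl])
    fix k
    have 1: "q powr (real (Suc k) * e) = q powr (real k * e) * q powr e"
      unfolding powr_add[symmetric] by (simp add: algebra_simps)
    have 2: "q powr (- b - real (Suc m) + e) = q powr (- b - real (Suc m)) * q powr e"
      unfolding powr_add[symmetric] by simp
    have 3: "c + real (Suc k) = c + 1 + real k" "b - real (Suc k) = b - 1 - real k"
      by auto
    show "- (q powr (- b - real (Suc m))) * ?h (Suc k) / (qfac q k * qfac q (n - k)) =
      q powr (- b - real (Suc m) + e) * ((- 1) ^ k *
         q powr (real k * (1 - real n + real l + real m)) *
         (\<Prod>i = 1..l. qnum q (c + 1 + real k + real i)) *
         (\<Prod>i = 1..m. qnum q (b - 1 - real k + real i)) / (qfac q k * qfac q (n - k)))"
      unfolding 1 2 3 e_def[symmetric] by (simp add: mult_ac)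
  qed
  finally show ?thesis
    by (simp add: e_def algebra_simps)
qed

text \<open>In both recurrences the first summand has too few factors and vanishes by induction, so
  only the summand at c + 1 and b - 1 can survive. The induction on l rests on one on m for l = 0,
  which ends in \<open>sum_alternating_qbinomial\<close>.\<close>

lemma qalt_sum_eq:
  assumes "q > 0" "l + m \<le> n"
  shows "qalt_sum q n l m c b =
    (if l + m = n then (- 1) ^ l * q powr (real l * (real n + b + c + 1) - real n * b) else 0)"
  using assms(2)
proof (induction l arbitrary: n c b)
  case 0
  then show ?case
  proof (induction m arbitrary: n c b)
    case 0
    show ?case
    proof (cases n)
      case 0
      then show ?thesis using assms by (simp add: qalt_sum_def)
    next
      case (Suc n')
      then show ?thesis
        using sum_alternating_qbinomial[OF assms(1), of n'] by (simp add: qalt_sum_def)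
    qed
  next
    case (Suc m)
    then obtain n' where n: "n = Suc n'" and le: "0 + m \<le> n'" by (cases n) auto
    have "q powr (- b - real (Suc m) + 1 - real n' + real 0 + real m) * q powr (- (real n' * (b - 1))) =
      q powr (- (real (Suc n') * b))"
      unfolding powr_add[symmetric] by (simp add: algebra_simps)
    then show ?case
      using le unfolding n qalt_sum_right[OF assms(1)] by (simp add: Suc.IH)
  qed
next
  case (Suc l)
  then obtain n' where n: "n = Suc n'" and le: "l + m \<le> n'" by (cases n) auto
  have "q powr (c + real (Suc l) + 1 - real n' + real l + real m) *
      q powr (real l * (real n' + (b - 1) + (c + 1) + 1) - real n' * (b - 1)) =
    q powr (real (Suc l) * (real (Suc n') + b + c + 1) - real (Suc n') * b)" if "n' = l + m"
    unfolding powr_add[symmetric] that by (simp add: algebra_simps)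
  then show ?case
    using le unfolding n qalt_sum_left[OF assms(1)] by (cases "n' = l + m") (simp_all add: Suc.IH)
qed

text \<open>Multiplying by [a+1] and splitting it at l gives two instances of the induction
  hypothesis, one at (a, b, c) and one, after an index shift, at (a, b-1, c+1). Their closed forms
  recombine by the addition formula for [a+b+c+1].\<close>

lemma q_Vandermonde:
  assumes "q > 0" "a \<le> b"
  shows "(\<Sum>l\<le>a. q powr (real l * (real a + real b + real c) - real a * real b) /
      (qfac q (b - l) * qfac q (c + l)) / (qfac q l * qfac q (a - l))) =
    qfac q (a + b + c) / (qfac q a * qfac q b * qfac q (a + c) * qfac q (b + c))"
  using assms(2)
proof (induction a arbitrary: b c)
  case 0
  then show ?case using assms by simp
next
  case (Suc a)
  then obtain b' where b: "b = Suc b'" and le: "a \<le> b'" by (cases b) auto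
  let ?e = "\<lambda>l. real l * (real (Suc a) + real b + real c) - real (Suc a) * real b"
  let ?D = "\<lambda>l. qfac q (b - l) * qfac q (c + l)"
  let ?B = "\<lambda>l. qfac q l * qfac q (Suc a - l)"
  have "qnum q (real (Suc a)) * (\<Sum>l\<le>Suc a. q powr ?e l / ?D l / ?B l) =
    (\<Sum>l\<le>Suc a. qnum q (real l) * (q powr (real (Suc a) - real l + ?e l) / ?D l) / ?B l +
      qnum q (real (Suc a) - real l) * (q powr (- real l + ?e l) / ?D l) / ?B l)"
    unfolding sum_distrib_left
  proof (rule sum.cong[OF refl])
    fix l
    have *: "qnum q (real (Suc a)) = q powr (real (Suc a) - real l) * qnum q (real l) +
        q powr (- real l) * qnum q (real (Suc a) - real l)"
      using qnum_add[OF assms(1), of "real l" "real (Suc a) - real l"] by simp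
    show "qnum q (real (Suc a)) * (q powr ?e l / ?D l / ?B l) =
      qnum q (real l) * (q powr (real (Suc a) - real l + ?e l) / ?D l) / ?B l +
      qnum q (real (Suc a) - real l) * (q powr (- real l + ?e l) / ?D l) / ?B l"
      unfolding * powr_add by (simp add: add_divide_distrib distrib_right distrib_left mult_ac del: of_nat_Suc)
  qed
  also have "\<dots> =
    (\<Sum>l\<le>a. q powr (real (Suc a) - real (Suc l) + ?e (Suc l)) / ?D (Suc l) / (qfac q l * qfac q (a - l))) +
    (\<Sum>l\<le>a. q powr (- real l + ?e l) / ?D l / (qfac q l * qfac q (a - l)))"
    unfolding sum.distrib sum_qnum_left[OF assms(1)] sum_qnum_right[OF assms(1)] ..
  also have "(\<Sum>l\<le>a. q powr (- real l + ?e l) / ?D l / (qfac q l * qfac q (a - l))) =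
      q powr (- real b) * (qfac q (a + b + c) / (qfac q a * qfac q b * qfac q (a + c) * qfac q (b + c)))"
    unfolding Suc.IH[OF Suc_leD[OF Suc.prems], symmetric] sum_distrib_left times_divide_eq_right
      powr_add[symmetric]
    by (intro sum.cong refl arg_cong2[where f = "(/)"] arg_cong2[where f = "(powr)"])
      (simp_all add: algebra_simps)
  also have "(\<Sum>l\<le>a. q powr (real (Suc a) - real (Suc l) + ?e (Suc l)) / ?D (Suc l) / (qfac q l * qfac q (a - l))) =
      q powr (real (a + c + 1)) *
        (qfac q (a + b' + Suc c) / (qfac q a * qfac q b' * qfac q (a + Suc c) * qfac q (b' + Suc c)))"
    unfolding Suc.IH[OF le, symmetric] sum_distrib_left times_divide_eq_right
      powr_add[symmetric]
    by (intro sum.cong refl arg_cong2[where f = "(/)"] arg_cong2[where f = "(powr)"])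
      (simp_all add: algebra_simps b)
  also have "q powr (real (a + c + 1)) *
        (qfac q (a + b' + Suc c) / (qfac q a * qfac q b' * qfac q (a + Suc c) * qfac q (b' + Suc c))) +
      q powr (- real b) * (qfac q (a + b + c) / (qfac q a * qfac q b * qfac q (a + c) * qfac q (b + c))) =
      qfac q (a + b + c) * (q powr (real (a + c + 1)) * qnum q (real b)
        + q powr (- real b) * qnum q (real (a + c + 1))) /
        (qfac q a * qfac q b * qfac q (Suc a + c) * qfac q (b + c))"
  proof -
    have "qnum q (real b) > 0" "qnum q (real (Suc (a + c))) > 0"
      using b by (auto intro!: qnum_pos[OF assms(1)])
    then show ?thesis
      using assms(1) unfolding b
      by (simp add: qfac_Suc divide_simps del: of_nat_Suc) (simp add: algebra_simps)
  qed
  also have "q powr (real (a + c + 1)) * qnum q (real b)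
        + q powr (- real b) * qnum q (real (a + c + 1)) = qnum q (real (Suc (a + b + c)))"
    using qnum_add[OF assms(1), of "real b" "real (a + c + 1)"] by (simp add: add_ac)
  also have "qfac q (a + b + c) * \<dots> / (qfac q a * qfac q b * qfac q (Suc a + c) * qfac q (b + c)) =
      qnum q (real (Suc a)) *
      (qfac q (Suc a + b + c) / (qfac q (Suc a) * qfac q b * qfac q (Suc a + c) * qfac q (b + c)))"
  proof -
    have "qnum q (real (Suc a)) > 0"
      by (auto intro!: qnum_pos[OF assms(1)])
    then show ?thesis by (simp add: qfac_Suc del: of_nat_Suc)
  qed
  finally have "qnum q (real (Suc a)) = 0 \<or> ?case"
    by (simp only: mult_cancel_left)
  then show ?case
    using qnum_pos[OF assms(1), of "real (Suc a)"] by (metis less_irrefl of_nat_0_less_iff zero_less_Suc)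
qed

section \<open>The double sum behind the orthonormality relation\<close>

text \<open>The index k runs over the polynomial belonging to J' and l over the one belonging to J.
  The two factorials in the numerator are those of the moment of order c + k + l for the weight with
  n = a + b' + c + 1.\<close>

definition vilenkin_sum :: "real \<Rightarrow> nat \<Rightarrow> nat \<Rightarrow> nat \<Rightarrow> nat \<Rightarrow> nat \<Rightarrow> real" where
  "vilenkin_sum q a' b' a b c = (\<Sum>k\<le>a'. \<Sum>l\<le>a.
     (- 1) ^ (k + l) *
     q powr ((real a - real a') * (real c + 1) + real k * (real a - real a' + 1) +
       real l * (real a - real a' - 1)) *
     (qfac q (c + k + l) * qfac q (a + b' - k - l)) /
     (qfac q k * qfac q (a' - k) * qfac q (b' - k) * qfac q (c + k) *
      (qfac q l * qfac q (a - l) * qfac q (b - l) * qfac q (c + l))))"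

text \<open>Exchanging the two summations flips the sign of the whole exponent of \<open>q\<close>,
  which is inversion of \<open>q\<close>. This carries the vanishing for a < a' over to a > a', and
  on the diagonal it makes both terms of the integrand contribute equally.\<close>

lemma vilenkin_sum_swap:
  assumes "q > 0" "a + b' = a' + b"
  shows "vilenkin_sum q a b a' b' c = vilenkin_sum (inverse q) a' b' a b c"
proof -
  have pw: "inverse q powr x = q powr (- x)" for x
    using assms by (simp add: powr_minus inverse_powr)
  have "vilenkin_sum (inverse q) a' b' a b c = (\<Sum>l\<le>a. \<Sum>k\<le>a'.
     (- 1) ^ (k + l) *
     q powr (- ((real a - real a') * (real c + 1) + real k * (real a - real a' + 1) +
       real l * (real a - real a' - 1))) *
     (qfac q (c + k + l) * qfac q (a + b' - k - l)) /
     (qfac q k * qfac q (a' - k) * qfac q (b' - k) * qfac q (c + k) *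
      (qfac q l * qfac q (a - l) * qfac q (b - l) * qfac q (c + l))))"
    unfolding vilenkin_sum_def qfac_inverse[OF assms(1)] pw by (rule sum.swap)
  also have "\<dots> = vilenkin_sum q a b a' b' c"
    unfolding vilenkin_sum_def
  proof (intro sum.cong refl)
    fix l k
    have 1: "- ((real a - real a') * (real c + 1) + real k * (real a - real a' + 1) +
       real l * (real a - real a' - 1)) = (real a' - real a) * (real c + 1) + real l * (real a' - real a + 1) +
       real k * (real a' - real a - 1)"
      by (simp add: algebra_simps)
    have 2: "a + b' - k - l = a' + b - l - k" "c + k + l = c + l + k" "k + l = l + k"
      using assms by auto
    show "(- 1) ^ (k + l) *
     q powr (- ((real a - real a') * (real c + 1) + real k * (real a - real a' + 1) +
       real l * (real a - real a' - 1))) *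
     (qfac q (c + k + l) * qfac q (a + b' - k - l)) /
     (qfac q k * qfac q (a' - k) * qfac q (b' - k) * qfac q (c + k) *
      (qfac q l * qfac q (a - l) * qfac q (b - l) * qfac q (c + l))) =
     (- 1) ^ (l + k) *
     q powr ((real a' - real a) * (real c + 1) + real l * (real a' - real a + 1) +
       real k * (real a' - real a - 1)) *
     (qfac q (c + l + k) * qfac q (a' + b - l - k)) /
     (qfac q l * qfac q (a - l) * qfac q (b - l) * qfac q (c + l) *
      (qfac q k * qfac q (a' - k) * qfac q (b' - k) * qfac q (c + k)))"
      unfolding 1 2 by (simp add: mult_ac)
  qed
  finally show ?thesis ..
qed

text \<open>For fixed l, [c+k+l]!/[c+k]! is a product of l q-numbers linear in k and
  [a+b'-k-l]!/[b'-k]! one of a - l. Together these are a factors, set against a q-binomial row of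
  length a'.\<close>

lemma vilenkin_sum_inner:
  assumes "q > 0" "a \<le> a'" "a' \<le> b'" "a + b' = a' + b"
  shows "vilenkin_sum q a' b' a b c = (\<Sum>l\<le>a. (- 1) ^ l *
      q powr ((real a - real a') * (real c + 1) + real l * (real a - real a' - 1)) *
      qalt_sum q a' l (a - l) (real c) (real b') /
      (qfac q l * qfac q (a - l) * qfac q (b - l) * qfac q (c + l)))"
  unfolding vilenkin_sum_def
proof (subst sum.swap, intro sum.cong refl)
  fix l assume "l \<in> {..a}"
  then have l: "l \<le> a" by simp
  show "(\<Sum>k\<le>a'. (- 1) ^ (k + l) *
     q powr ((real a - real a') * (real c + 1) + real k * (real a - real a' + 1) +
       real l * (real a - real a' - 1)) *
     (qfac q (c + k + l) * qfac q (a + b' - k - l)) /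
     (qfac q k * qfac q (a' - k) * qfac q (b' - k) * qfac q (c + k) *
      (qfac q l * qfac q (a - l) * qfac q (b - l) * qfac q (c + l)))) =
    (- 1) ^ l *
      q powr ((real a - real a') * (real c + 1) + real l * (real a - real a' - 1)) *
      qalt_sum q a' l (a - l) (real c) (real b') /
      (qfac q l * qfac q (a - l) * qfac q (b - l) * qfac q (c + l))"
    unfolding qalt_sum_def sum_distrib_left sum_divide_distrib
  proof (rule sum.cong[OF refl])
    fix k assume "k \<in> {..a'}"
    then have k: "k \<le> b'" using assms by simp
    have 1: "qfac q (c + k + l) = qfac q (c + k) * (\<Prod>i = 1..l. qnum q (real c + real k + real i))"
      by (simp add: qfac_add)
    have "a + b' - k - l = (b' - k) + (a - l)" using k l by simp
    then have 2: "qfac q (a + b' - k - l) = qfac q (b' - k) * (\<Prod>i = 1..a - l. qnum q (real b' - real k + real i))"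
      using k qfac_add[of q "b' - k" "a - l"] by (simp add: of_nat_diff del: diff_diff_left add_diff_assoc add_diff_assoc2)
    have 3: "(real a - real a') * (real c + 1) + real k * (real a - real a' + 1) +
       real l * (real a - real a' - 1) = ((real a - real a') * (real c + 1) + real l * (real a - real a' - 1))
       + (real k * (1 - real a' + real l + real (a - l)))"
      using l by (simp add: of_nat_diff algebra_simps)
    show "(- 1) ^ (k + l) *
     q powr ((real a - real a') * (real c + 1) + real k * (real a - real a' + 1) +
       real l * (real a - real a' - 1)) *
     (qfac q (c + k + l) * qfac q (a + b' - k - l)) /
     (qfac q k * qfac q (a' - k) * qfac q (b' - k) * qfac q (c + k) *
      (qfac q l * qfac q (a - l) * qfac q (b - l) * qfac q (c + l))) =
     (- 1) ^ l *
      q powr ((real a - real a') * (real c + 1) + real l * (real a - real a' - 1)) *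
      ((- 1) ^ k * q powr (real k * (1 - real a' + real l + real (a - l))) *
      (\<Prod>i = 1..l. qnum q (real c + real k + real i)) *
      (\<Prod>i = 1..a - l. qnum q (real b' - real k + real i)) / (qfac q k * qfac q (a' - k))) /
      (qfac q l * qfac q (a - l) * qfac q (b - l) * qfac q (c + l))"
      unfolding 1 2 3 powr_add power_add using assms(1) by (simp add: field_simps)
  qed
qed

text \<open>For a < a' every inner sum has only a < a' factors and vanishes by
  \<open>qalt_sum_eq\<close>; the case a > a' follows by the swap.\<close>

lemma vilenkin_sum_eq_0:
  assumes "q > 0" "a \<noteq> a'" "a \<le> b" "a' \<le> b'" "a + b' = a' + b"
  shows "vilenkin_sum q a' b' a b c = 0"
proof -
  have *: "vilenkin_sum p x' y' x y c = 0" if "p > 0" "x < x'" "x' \<le> y'" "x + y' = x' + y" for p x' y' x y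
    using that by (subst vilenkin_sum_inner) (auto intro!: sum.neutral simp: qalt_sum_eq)
  show ?thesis
  proof (cases "a < a'")
    case True
    then show ?thesis using * assms by simp
  next
    case False
    then show ?thesis
      using *[of "inverse q" a' a b b'] vilenkin_sum_swap[of q a' b a b' c] assms by simp
  qed
qed

text \<open>With a = a' each inner sum is in the critical case l + (a - l) = a of
  \<open>qalt_sum_eq\<close>. Its sign cancels the outer one, and the left side of
  \<open>q_Vandermonde\<close> remains.\<close>

lemma vilenkin_sum_diagonal:
  assumes "q > 0" "a \<le> b"
  shows "vilenkin_sum q a b a b c = qfac q (a + b + c) / (qfac q a * qfac q b * qfac q (a + c) * qfac q (b + c))"
proof -
  have "vilenkin_sum q a b a b c = (\<Sum>l\<le>a. q powr (real l * (real a + real b + real c) - real a * real b) /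
      (qfac q (b - l) * qfac q (c + l)) / (qfac q l * qfac q (a - l)))"
    unfolding vilenkin_sum_inner[OF assms(1) order_refl assms(2) refl]
  proof (rule sum.cong[OF refl])
    fix l assume "l \<in> {..a}"
    then have l: "l + (a - l) = a" by simp
    have 1: "qalt_sum q a l (a - l) (real c) (real b) =
        (- 1) ^ l * q powr (real l * (real a + real b + real c + 1) - real a * real b)"
      using qalt_sum_eq[OF assms(1), of l "a - l" a] l by simp
    have 2: "q powr (real l * (real a + real b + real c) - real a * real b) = q powr (- real l) *
       q powr (real l * (real a + real b + real c + 1) - real a * real b)"
      unfolding powr_add[symmetric] by (simp add: algebra_simps)
    have 3: "(- 1) ^ l * ((- 1) ^ l * x) = x" for x :: real
      by (simp add: mult.assoc[symmetric] flip: power_mult_distrib)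
    show "(- 1) ^ l * q powr ((real a - real a) * (real c + 1) + real l * (real a - real a - 1)) *
      qalt_sum q a l (a - l) (real c) (real b) / (qfac q l * qfac q (a - l) * qfac q (b - l) * qfac q (c + l)) =
      q powr (real l * (real a + real b + real c) - real a * real b) /
      (qfac q (b - l) * qfac q (c + l)) / (qfac q l * qfac q (a - l))"
      unfolding 1 2 by (simp add: mult_ac 3)
  qed
  with q_Vandermonde[OF assms] show ?thesis by simp
qed

subsection \<open>Moments\<close>

text \<open>The exponents run symmetrically from -n to n in steps of two, so that inverting
  \<open>q\<close> only reverses the factors. There are n + 1 of them, so the moments of order a < n
  are finite.\<close>

definition qweight :: "real \<Rightarrow> nat \<Rightarrow> real \<Rightarrow> real" where
  "qweight q n x = (\<Prod>k\<le>n. 1 + q powr (2 * real k - real n) * x)"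

lemma qweight_pos: "x \<ge> 0 \<Longrightarrow> qweight q n x > 0"
  unfolding qweight_def by (intro prod_pos) (auto intro!: add_pos_nonneg)

lemma qweight_Suc_left:
  assumes "q > 0"
  shows "qweight q (Suc n) x = (1 + q powr (- real (Suc n)) * x) * qweight q n (q * x)"
proof -
  have "q powr (2 * real (Suc k) - real (Suc n)) * x = q powr (2 * real k - real n) * (q * x)" for k
  proof -
    have "2 * real (Suc k) - real (Suc n) = (2 * real k - real n) + 1"
      by simp
    then show ?thesis
      using assms by (simp only: powr_add powr_one mult.assoc)
  qed
  moreover have "2 * real 0 - real (Suc n) = - real (Suc n)"
    by simp
  ultimately show ?thesis
    unfolding qweight_def prod.atMost_Suc_shift by (simp only:)
qed

lemma qweight_Suc_right:
  assumes "q > 0"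
  shows "qweight q (Suc n) x = (1 + q powr real (Suc n) * x) * qweight q n (x / q)"
proof -
  have "q powr (2 * real k - real (Suc n)) * x = q powr (2 * real k - real n) * (x / q)" for k
    using assms by (simp add: powr_diff powr_add del: of_nat_Suc) (simp add: powr_add)
  moreover have "2 * real (Suc n) - real (Suc n) = real (Suc n)"
    by simp
  ultimately show ?thesis
    unfolding qweight_def prod.atMost_Suc by (simp only: mult.commute)
qed

text \<open>The substitution \<open>g\<close>, which is the map \<open>eta_of\<close>, turns the
  integrand into the constant 1/2 on a bounded interval.\<close>

lemma absolutely_integrable_inverse_square:
  "(\<lambda>x::real. 1 / (1 + x)\<^sup>2) absolutely_integrable_on {0<..}"
proof -
  define g where "g = (\<lambda>x::real. (1 + x) / (1 - x))"
  have "g ` {-1<..<1} = {0<..}"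
  proof (intro equalityI subsetI)
    fix y :: real assume "y \<in> {0<..}"
    then show "y \<in> g ` {-1<..<1}"
      by (intro image_eqI[of _ _ "(y - 1) / (y + 1)"]) (auto simp: g_def field_simps)
  qed (auto simp: g_def)
  moreover have "inj_on g {-1<..<1}"
    by (auto simp: inj_on_def g_def field_simps)
  moreover have "(g has_field_derivative 2 / (1 - x)\<^sup>2) (at x within {-1<..<1})" if "x \<in> {-1<..<1}" for x
    unfolding g_def using that
    by (auto intro!: derivative_eq_intros simp: power2_eq_square field_simps)
  moreover have "(\<lambda>x. \<bar>2 / (1 - x)\<^sup>2\<bar> * (1 / (1 + g x)\<^sup>2)) absolutely_integrable_on {-1<..<1}"
  proof -
    have "\<bar>2 / (1 - x)\<^sup>2\<bar> * (1 / (1 + g x)\<^sup>2) = 1 / 2" if x: "x \<in> {-1<..<1}" for x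
    proof -
      have "1 + g x = 2 / (1 - x)"
        using x by (auto simp: g_def field_simps)
      then have "(1 + g x)\<^sup>2 = 4 / (1 - x)\<^sup>2"
        by (simp add: power_divide)
      then show ?thesis
        using x by simp
    qed
    then have "(\<lambda>x. \<bar>2 / (1 - x)\<^sup>2\<bar> * (1 / (1 + g x)\<^sup>2)) absolutely_integrable_on {-1<..<1} \<longleftrightarrow>
      (\<lambda>x. 1 / 2 :: real) absolutely_integrable_on {-1<..<1::real}"
      by (rule set_integrable_cong[OF refl refl])
    moreover have "(\<lambda>x. 1 / 2 :: real) absolutely_integrable_on {-1<..<1::real}"
      by (rule absolutely_integrable_on_const) auto
    ultimately show ?thesis by blast
  qed
  ultimately show ?thesis
    using absolutely_integrable_change_of_variables_1'[of "{-1<..<1}" g "\<lambda>x. 2 / (1 - x)\<^sup>2" "\<lambda>x. 1 / (1 + x)\<^sup>2"]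
    by auto
qed

text \<open>Each of the n + 1 factors of the weight is at least m (1 + x), so the integrand is
  dominated by a multiple of 1/(1+x)^2.\<close>

lemma absolutely_integrable_qweight:
  assumes "q > 0" "a < n"
  shows "(\<lambda>x. x ^ a / qweight q n x) absolutely_integrable_on {0<..}"
proof -
  \<comment> \<open>Inserting 1 gives m <= 1, which bounds the constant term in m (1 + x); the other
    elements bound the coefficients of x.\<close>
  define m where "m = Min (insert 1 ((\<lambda>k. q powr (2 * real k - real n)) ` {..n}))"
  have m: "0 < m" "m \<le> 1"
    using assms by (auto simp: m_def)
  have mk: "m \<le> q powr (2 * real k - real n)" if "k \<le> n" for k
    unfolding m_def by (rule Min_le) (use that in auto)
  show ?thesis
  proof (rule measurable_bounded_by_integrable_imp_absolutely_integrable)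
    show "(\<lambda>x. x ^ a / qweight q n x) \<in> borel_measurable (lebesgue_on {0<..})"
    proof (rule continuous_imp_measurable_on_sets_lebesgue)
      have "x \<in> {0<..} \<Longrightarrow> qweight q n x \<noteq> 0" for x :: real
        using qweight_pos[of x q n] by auto
      then show "continuous_on {0<..} (\<lambda>x. x ^ a / qweight q n x)"
        unfolding qweight_def by (intro continuous_intros) auto
    qed auto
    show "(\<lambda>x. inverse (m ^ Suc n) * (1 / (1 + x)\<^sup>2)) integrable_on {0<..}"
      by (intro integrable_on_mult_right set_lebesgue_integral_eq_integral(1)
        absolutely_integrable_inverse_square)
    fix x :: real assume "x \<in> {0<..}"
    then have x: "x > 0" by simp
    have "m ^ Suc n * (1 + x) ^ Suc n = (\<Prod>k\<le>n. m * (1 + x))"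
      by (simp add: power_mult_distrib)
    also have "\<dots> \<le> qweight q n x"
      unfolding qweight_def
    proof (rule prod_mono, intro conjI)
      fix k assume "k \<in> {..n}"
      then have "m * x \<le> q powr (2 * real k - real n) * x"
        using mk x by (intro mult_right_mono) auto
      with m show "m * (1 + x) \<le> 1 + q powr (2 * real k - real n) * x"
        by (simp add: distrib_left)
    qed (use m x in auto)
    finally have le: "m ^ Suc n * (1 + x) ^ Suc n \<le> qweight q n x" .
    \<comment> \<open>Since a < n, the exponent a + 2 is at most n + 1, which leaves two powers of 1
      + x for the majorant.\<close>
    have "x ^ a * (1 + x)\<^sup>2 \<le> (1 + x) ^ a * (1 + x)\<^sup>2"
      using x by (intro mult_right_mono power_mono) auto
    also have "\<dots> = (1 + x) ^ (a + 2)" by (simp only: power_add)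
    also have "\<dots> \<le> (1 + x) ^ Suc n"
      using x assms by (intro power_increasing) auto
    finally have "m ^ Suc n * (x ^ a * (1 + x)\<^sup>2) \<le> m ^ Suc n * (1 + x) ^ Suc n"
      using m by (intro mult_left_mono) auto
    with le have *: "m ^ Suc n * (x ^ a * (1 + x)\<^sup>2) \<le> qweight q n x" by linarith
    have "norm (x ^ a / qweight q n x) = x ^ a / qweight q n x"
      using x qweight_pos[of x q n] by auto
    also have "\<dots> \<le> x ^ a / (m ^ Suc n * (x ^ a * (1 + x)\<^sup>2))"
      using * x m qweight_pos[of x q n] by (intro divide_left_mono) (auto intro!: mult_pos_pos)
    also have "\<dots> = inverse (m ^ Suc n) * (1 / (1 + x)\<^sup>2)"
      using x m by (simp add: field_simps)
    finally show "norm (x ^ a / qweight q n x) \<le> inverse (m ^ Suc n) * (1 / (1 + x)\<^sup>2)" .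
  qed auto
qed

lemma diff_inverse_nonzero:
  assumes "q > 0" "q \<noteq> (1::real)"
  shows "q - inverse q \<noteq> 0"
proof
  assume "q - inverse q = 0"
  then have "q\<^sup>2 = 1" using assms by (simp add: field_simps power2_eq_square)
  with assms show False by (simp add: power2_eq_1_iff)
qed

lemma qnum_1: "q > 0 \<Longrightarrow> qnum q 1 = 1"
  using diff_inverse_nonzero[of q] by (cases "q = 1") (simp_all add: qnum_def powr_minus)

section \<open>Moments of the weight: recurrences and closed form\<close>

definition qmoment :: "real \<Rightarrow> nat \<Rightarrow> nat \<Rightarrow> real" where
  "qmoment q a n = integral {0<..} (\<lambda>x. x ^ a / qweight q n x)"

lemma qmoment_has_integral:
  assumes "q > 0" "a < n"
  shows "((\<lambda>x. x ^ a / qweight q n x) has_integral qmoment q a n) {0<..}"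
  unfolding qmoment_def
  by (intro integrable_integral set_lebesgue_integral_eq_integral(1) absolutely_integrable_qweight assms)

lemma qmoment_scaled:
  assumes "c > 0" "q > 0" "a < n"
  shows "((\<lambda>x. x ^ a / qweight q n (c * x)) has_integral qmoment q a n / c ^ Suc a) {0<..}"
proof -
  have "(\<lambda>x. c * x) ` {0<..} = {0<..}"
  proof (intro equalityI subsetI)
    fix y :: real assume "y \<in> {0<..}"
    then show "y \<in> (\<lambda>x. c * x) ` {0<..}"
      using assms by (intro image_eqI[of _ _ "y / c"]) auto
  qed (use assms in auto)
  then have "(\<lambda>x. \<bar>c\<bar> * ((c * x) ^ a / qweight q n (c * x))) absolutely_integrable_on {0<..} \<and>
    integral {0<..} (\<lambda>x. \<bar>c\<bar> * ((c * x) ^ a / qweight q n (c * x))) = qmoment q a n"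
    using absolutely_integrable_qweight[OF assms(2,3)] assms(1)
    by (subst has_absolute_integral_change_of_variables_1')
      (auto simp: qmoment_def inj_on_def intro!: derivative_eq_intros)
  then have "((\<lambda>x. \<bar>c\<bar> * ((c * x) ^ a / qweight q n (c * x))) has_integral qmoment q a n) {0<..}"
    by (metis set_lebesgue_integral_eq_integral(1) integrable_integral)
  then have "((\<lambda>x. (1 / c ^ Suc a) * (\<bar>c\<bar> * ((c * x) ^ a / qweight q n (c * x)))) has_integral
      (1 / c ^ Suc a) * qmoment q a n) {0<..}"
    by (rule has_integral_mult_right)
  then show ?thesis
    using assms by (simp add: power_mult_distrib)
qed

text \<open>Two evaluations of the integral of x^a / w_n(q x): by rescaling x, and by restoring the
  factor of w_(n+1) that \<open>qweight_Suc_left\<close> splits off.\<close>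

lemma qmoment_Suc_left:
  assumes "q > 0" "a < n"
  shows "qmoment q a n / q ^ Suc a = qmoment q a (Suc n) + q powr (- real (Suc n)) * qmoment q (Suc a) (Suc n)"
proof (rule has_integral_unique)
  have "((\<lambda>x. x ^ a / qweight q (Suc n) x + q powr (- real (Suc n)) * (x ^ Suc a / qweight q (Suc n) x))
    has_integral qmoment q a (Suc n) + q powr (- real (Suc n)) * qmoment q (Suc a) (Suc n)) {0<..}"
    using assms by (intro has_integral_add has_integral_mult_right qmoment_has_integral) auto
  then show "((\<lambda>x. x ^ a / qweight q n (q * x)) has_integral
     qmoment q a (Suc n) + q powr (- real (Suc n)) * qmoment q (Suc a) (Suc n)) {0<..}"
  proof (rule has_integral_eq[rotated])
    fix x :: real assume x: "x \<in> {0<..}"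
    then have "1 + q powr (- real (Suc n)) * x > 0" "qweight q n (q * x) > 0"
      using assms by (auto intro!: add_pos_nonneg qweight_pos)
    moreover have "x ^ a / qweight q (Suc n) x + q powr (- real (Suc n)) * (x ^ Suc a / qweight q (Suc n) x) =
        ((1 + q powr (- real (Suc n)) * x) * x ^ a) / qweight q (Suc n) x"
      by (simp add: add_divide_distrib distrib_right mult.assoc)
    ultimately show "x ^ a / qweight q (Suc n) x + q powr (- real (Suc n)) * (x ^ Suc a / qweight q (Suc n) x) =
        x ^ a / qweight q n (q * x)"
      unfolding qweight_Suc_left[OF assms(1)] by simp
  qed
  show "((\<lambda>x. x ^ a / qweight q n (q * x)) has_integral qmoment q a n / q ^ Suc a) {0<..}"
    using assms by (intro qmoment_scaled)
qed

text \<open>The same double evaluation for x^a / w_n(x / q), with the top factor of w_(n+1) restored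
  instead of the bottom one.\<close>

lemma qmoment_Suc_right:
  assumes "q > 0" "a < n"
  shows "qmoment q a n * q ^ Suc a = qmoment q a (Suc n) + q powr real (Suc n) * qmoment q (Suc a) (Suc n)"
proof (rule has_integral_unique)
  have "((\<lambda>x. x ^ a / qweight q (Suc n) x + q powr real (Suc n) * (x ^ Suc a / qweight q (Suc n) x))
    has_integral qmoment q a (Suc n) + q powr real (Suc n) * qmoment q (Suc a) (Suc n)) {0<..}"
    using assms by (intro has_integral_add has_integral_mult_right qmoment_has_integral) auto
  then show "((\<lambda>x. x ^ a / qweight q n (x / q)) has_integral
     qmoment q a (Suc n) + q powr real (Suc n) * qmoment q (Suc a) (Suc n)) {0<..}"
  proof (rule has_integral_eq[rotated])
    fix x :: real assume x: "x \<in> {0<..}"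
    then have "1 + q powr real (Suc n) * x > 0" "qweight q n (x / q) > 0"
      using assms by (auto intro!: add_pos_nonneg qweight_pos)
    moreover have "x ^ a / qweight q (Suc n) x + q powr real (Suc n) * (x ^ Suc a / qweight q (Suc n) x) =
        ((1 + q powr real (Suc n) * x) * x ^ a) / qweight q (Suc n) x"
      by (simp add: add_divide_distrib distrib_right mult.assoc)
    ultimately show "x ^ a / qweight q (Suc n) x + q powr real (Suc n) * (x ^ Suc a / qweight q (Suc n) x) =
        x ^ a / qweight q n (x / q)"
      unfolding qweight_Suc_right[OF assms(1)] by simp
  qed
  show "((\<lambda>x. x ^ a / qweight q n (x / q)) has_integral qmoment q a n * q ^ Suc a) {0<..}"
    using qmoment_scaled[of "1 / q" q a n] assms by (simp add: power_one_over field_simps)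
qed

text \<open>Transfers the fundamental theorem for Lebesgue interval integrals on extended reals to a
  \<open>has_integral\<close> statement on the half-line.\<close>

lemma has_integral_FTC_pos_real:
  fixes F f :: "real \<Rightarrow> real"
  assumes "\<And>x. x > 0 \<Longrightarrow> (F has_real_derivative f x) (at x)"
    and "continuous_on {0<..} f" "f absolutely_integrable_on {0<..}"
    and "(F \<longlongrightarrow> A) (at_right 0)" "(F \<longlongrightarrow> B) at_top"
  shows "(f has_integral B - A) {0<..}"
proof -
  have ein: "einterval 0 \<infinity> = {0<..}"
    by (auto simp: einterval_def zero_ereal_def)
  have cont: "isCont f x" if "x > 0" for x
    using assms(2) that by (simp add: continuous_on_eq_continuous_at)
  have "(\<lambda>x. indicator {0<..} x *\<^sub>R f x) \<in> borel_measurable lborel"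
    using borel_measurable_continuous_on_indicator[OF _ assms(2)] by simp
  \<comment> \<open>Absolute integrability refers to the completed measure; Borel measurability,
    from continuity, allows the passage to \<open>lborel\<close>.\<close>
  then have 1: "set_integrable lborel {0<..} f"
    using assms(3) unfolding set_integrable_def by (simp only: integrable_completion)
  have "(LBINT x=0..\<infinity>. f x) = B - A"
  proof (rule interval_integral_FTC_integrable[of 0 "\<infinity>" F f])
    show "((F \<circ> real_of_ereal) \<longlongrightarrow> A) (at_right 0)"
      using assms(4) unfolding zero_ereal_def by (simp add: ereal_tendsto_simps)
    show "((F \<circ> real_of_ereal) \<longlongrightarrow> B) (at_left \<infinity>)"
      using assms(5) by (simp add: ereal_tendsto_simps)
    show "set_integrable lborel (einterval 0 \<infinity>) f"
      using 1 ein by simp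
  qed (use assms(1) cont in \<open>auto simp: zero_ereal_def has_real_derivative_iff_has_vector_derivative[symmetric]\<close>)
  moreover have "(LBINT x=0..\<infinity>. f x) = (LBINT x:{0<..}. f x)"
    by (simp add: interval_lebesgue_integral_def ein)
  ultimately show ?thesis
    using set_borel_integral_eq_integral[OF 1] by (simp add: has_integral_iff)
qed

lemma qweight_1: "qweight 1 n x = (1 + x) ^ Suc n"
  by (simp add: qweight_def)

text \<open>The base moment, and the origin of the logarithm in the normalisation: an elementary
  antiderivative has limit 2 ln q / (q - 1/q) at infinity, and the case q = 1 uses -1/(1+x).\<close>

lemma qmoment_0_1:
  assumes "q > 0"
  shows "qmoment q 0 1 = 2 / qlog_ratio q"
proof (rule has_integral_unique[OF qmoment_has_integral[OF assms]])
  have ai: "(\<lambda>x. x ^ 0 / qweight q 1 x) absolutely_integrable_on {0<..}"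
    using assms by (intro absolutely_integrable_qweight) auto
  have w: "qweight q 1 x = (1 + x / q) * (1 + q * x)" for x
    using assms by (simp add: qweight_def powr_minus divide_inverse mult.commute)
  have nz: "qweight q 1 x \<noteq> 0" if "x > 0" for x
    using that qweight_pos[of x q 1] by simp
  have cont: "continuous_on {0<..} (\<lambda>x. x ^ 0 / qweight q 1 x)"
    using nz assms unfolding w by (intro continuous_intros) auto
  show "((\<lambda>x. x ^ 0 / qweight q 1 x) has_integral 2 / qlog_ratio q) {0<..}"
  proof (cases "q = 1")
    case True
    have "((\<lambda>x. x ^ 0 / qweight q 1 x) has_integral 0 - (- 1)) {0<..}"
    proof (rule has_integral_FTC_pos_real[OF _ cont ai])
      fix x :: real assume "x > 0"
      then show "((\<lambda>x. - 1 / (1 + x)) has_real_derivative x ^ 0 / qweight q 1 x) (at x)"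
        unfolding w by (auto intro!: derivative_eq_intros simp: True)
    next
      have "((\<lambda>x. - 1 / (1 + x :: real)) \<longlongrightarrow> - 1 / (1 + 0)) (at_right 0)"
        by (intro tendsto_intros) auto
      then show "((\<lambda>x. - 1 / (1 + x :: real)) \<longlongrightarrow> - 1) (at_right 0)" by simp
      show "((\<lambda>x. - 1 / (1 + x :: real)) \<longlongrightarrow> 0) at_top" by real_asymp
    qed
    then show ?thesis by (simp add: True qlog_ratio_def)
  next
    case False
    define D where "D = q - inverse q"
    have D: "D \<noteq> 0"
      unfolding D_def using assms False by (rule diff_inverse_nonzero)
    \<comment> \<open>Partial fractions: 1/w_1(x) is the difference of q/(1+qx) and (1/q)/(1+x/q),
      divided by \<open>D\<close>.\<close>
    define F where "F = (\<lambda>x. (ln (1 + q * x) - ln (1 + x / q)) / D)"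
    have "((\<lambda>x. x ^ 0 / qweight q 1 x) has_integral 2 * ln q / D - 0) {0<..}"
    proof (rule has_integral_FTC_pos_real[OF _ cont ai])
      fix x :: real assume x: "x > 0"
      have pos: "1 + q * x > 0" "1 + x / q > 0" using x assms by (auto intro!: add_pos_pos)
      have "(F has_real_derivative (q / (1 + q * x) - (1 / q) / (1 + x / q)) / D) (at x)"
        unfolding F_def using pos assms D by (auto intro!: derivative_eq_intros)
      moreover have "q / (1 + q * x) - (1 / q) / (1 + x / q) = D / ((1 + x / q) * (1 + q * x))"
        using pos assms by (simp add: D_def divide_simps) (simp add: algebra_simps)
      ultimately show "(F has_real_derivative x ^ 0 / qweight q 1 x) (at x)"
        using D by (simp add: w del: One_nat_def)
    next
      have "(F \<longlongrightarrow> (ln (1 + q * 0) - ln (1 + 0 / q)) / D) (at_right 0)"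
        unfolding F_def using assms D by (intro tendsto_intros) auto
      then show "(F \<longlongrightarrow> 0) (at_right 0)" by simp
      have "((\<lambda>x. (1 + q * x) / (1 + x / q)) \<longlongrightarrow> q\<^sup>2) at_top"
        using assms by real_asymp (simp add: power2_eq_square field_simps)
      then have "((\<lambda>x. ln ((1 + q * x) / (1 + x / q)) / D) \<longlongrightarrow> ln (q\<^sup>2) / D) at_top"
        using assms D by (intro tendsto_intros) auto
      moreover have "eventually (\<lambda>x. ln ((1 + q * x) / (1 + x / q)) / D = F x) at_top"
        using eventually_gt_at_top[of 0]
      proof eventually_elim
        case (elim x)
        then have "1 + q * x > 0" "1 + x / q > 0" using assms by (auto intro!: add_pos_pos)
        then show ?case by (simp add: F_def ln_div)
      qed
      ultimately have "(F \<longlongrightarrow> ln (q\<^sup>2) / D) at_top"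
        by (rule Lim_transform_eventually)
      then show "(F \<longlongrightarrow> 2 * ln q / D) at_top"
        using assms by (simp add: ln_realpow)
    qed
    then show ?thesis using False by (simp add: qlog_ratio_def D_def)
  qed
qed simp

text \<open>For \<open>q\<close> other than 1, eliminate \<open>qmoment q a (Suc n)\<close> from the
  left and right recurrences. At q = 1 these coincide, and the identity comes instead from
  integrating the derivative of x^(a+1)/(1+x)^(n+1), which vanishes at both ends.\<close>

lemma qmoment_Suc_Suc:
  assumes "q > 0" "a < n"
  shows "qnum q (real (Suc n)) * qmoment q (Suc a) (Suc n) = qnum q (real (Suc a)) * qmoment q a n"
proof (cases "q = 1")
  case True
  have I: "((\<lambda>x. real (Suc a) * (x ^ a / qweight 1 n x) - real (Suc n) * (x ^ Suc a / qweight 1 (Suc n) x))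
    has_integral real (Suc a) * qmoment 1 a n - real (Suc n) * qmoment 1 (Suc a) (Suc n)) {0<..}"
    using assms by (intro has_integral_diff has_integral_mult_right qmoment_has_integral) auto
  have "((\<lambda>x. real (Suc a) * (x ^ a / qweight 1 n x) - real (Suc n) * (x ^ Suc a / qweight 1 (Suc n) x))
    has_integral 0 - 0) {0<..}"
  proof (rule has_integral_FTC_pos_real)
    fix x :: real assume x: "x > 0"
    have e: "real (Suc a) * (x ^ a / qweight 1 n x) - real (Suc n) * (x ^ Suc a / qweight 1 (Suc n) x) =
      (real (Suc a) * x ^ a * (1 + x) ^ Suc n - x ^ Suc a * (real (Suc n) * (1 + x) ^ n)) /
        ((1 + x) ^ Suc n * (1 + x) ^ Suc n)"
    proof -
      define y u where "y = 1 + x" and "u = y ^ n"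
      have "y \<noteq> 0" "u \<noteq> 0" using x by (auto simp: y_def u_def)
      then show ?thesis
        unfolding qweight_1 y_def[symmetric] power_Suc[of y] u_def[symmetric]
        by (simp add: divide_simps del: of_nat_Suc) (simp add: algebra_simps)
    qed
    have nz: "(1 + x) ^ Suc n \<noteq> 0" using x by simp
    show "((\<lambda>x. x ^ Suc a / (1 + x) ^ Suc n) has_real_derivative
      real (Suc a) * (x ^ a / qweight 1 n x) - real (Suc n) * (x ^ Suc a / qweight 1 (Suc n) x)) (at x)"
      unfolding e using nz x
      by (auto intro!: derivative_eq_intros simp del: power_Suc of_nat_Suc)
  next
    have nz: "1 + x \<noteq> 0" if "x \<in> {0<..}" for x :: real using that by auto
    show "continuous_on {0<..} (\<lambda>x. real (Suc a) * (x ^ a / qweight 1 n x) - real (Suc n) * (x ^ Suc a / qweight 1 (Suc n) x))"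
      unfolding qweight_1 using nz by (intro continuous_intros) auto
    show "(\<lambda>x. real (Suc a) * (x ^ a / qweight 1 n x) - real (Suc n) * (x ^ Suc a / qweight 1 (Suc n) x)) absolutely_integrable_on {0<..}"
      using assms
      by (intro set_integral_diff set_integrable_mult_right absolutely_integrable_qweight) auto
    have "((\<lambda>x. x ^ Suc a / (1 + x) ^ Suc n) \<longlongrightarrow> 0 ^ Suc a / (1 + 0) ^ Suc n) (at_right (0::real))"
      by (intro tendsto_intros) auto
    then show "((\<lambda>x. x ^ Suc a / (1 + x) ^ Suc n) \<longlongrightarrow> 0) (at_right (0::real))" by simp
    show "((\<lambda>x::real. x ^ Suc a / (1 + x) ^ Suc n) \<longlongrightarrow> 0) at_top"
    proof (rule tendsto_sandwich[of "\<lambda>x. 0" _ _ "\<lambda>x. 1 / (1 + x)"])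
      show "\<forall>\<^sub>F x::real in at_top. x ^ Suc a / (1 + x) ^ Suc n \<le> 1 / (1 + x)"
        using eventually_gt_at_top[of 0]
      proof eventually_elim
        case (elim x)
        have "x ^ Suc a \<le> (1 + x) ^ Suc a" using elim by (intro power_mono) auto
        also have "\<dots> \<le> (1 + x) ^ n" using elim assms by (intro power_increasing) auto
        finally have "x ^ Suc a / (1 + x) ^ Suc n \<le> (1 + x) ^ n / (1 + x) ^ Suc n"
          using elim by (intro divide_right_mono) auto
        then show ?case using elim by simp
      qed
      show "((\<lambda>x::real. 1 / (1 + x)) \<longlongrightarrow> 0) at_top" by real_asymp
      show "\<forall>\<^sub>F x::real in at_top. 0 \<le> x ^ Suc a / (1 + x) ^ Suc n"
        using eventually_gt_at_top[of 0] by eventually_elim auto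
    qed auto
  qed
  from has_integral_unique[OF this I] show ?thesis
    by (simp add: True qnum_def)
next
  case False
  have pw: "q powr real (Suc k) = q ^ Suc k" "q powr - real (Suc k) = 1 / q ^ Suc k" for k
    using assms by (simp_all only: powr_realpow powr_minus_divide)
  \<comment> \<open>To be read with A = q^(a+1), C = q^(n+1) and D = q - 1/q: subtracting the two
    hypotheses removes x.\<close>
  have *: "(C - 1 / C) / D * y = (A - 1 / A) / D * m" if "m / A = x + 1 / C * y" "m * A = x + C * y"
    for A C D m x y :: real
  proof -
    have "(C - 1 / C) * y = (A - 1 / A) * m"
      using that by (simp add: algebra_simps)
    then show ?thesis by simp
  qed
  show ?thesis
    unfolding qnum_def pw if_not_P[OF False]
    by (rule *[OF qmoment_Suc_left[OF assms, unfolded pw] qmoment_Suc_right[OF assms, unfolded pw]])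
qed

text \<open>Inserting \<open>qmoment_Suc_Suc\<close> into the right recurrence leaves the
  coefficient [n+1] q^(a+1) - q^(n+1) [a+1], which is [n-a] by the addition formula.\<close>

lemma qmoment_Suc:
  assumes "q > 0" "a < n"
  shows "qnum q (real (Suc n)) * qmoment q a (Suc n) = qnum q (real (n - a)) * qmoment q a n"
proof -
  have "qmoment q a n * q ^ Suc a = qmoment q a (Suc n) + q powr real (Suc n) * qmoment q (Suc a) (Suc n)"
    using qmoment_Suc_right[OF assms] .
  moreover have "N * A = N * Q * m - P * (N * B)" if "m * Q = A + P * B" for N A Q m P B :: real
    using that by algebra
  ultimately have "qnum q (real (Suc n)) * qmoment q a (Suc n) = qnum q (real (Suc n)) * q ^ Suc a * qmoment q a n
      - q powr real (Suc n) * (qnum q (real (Suc n)) * qmoment q (Suc a) (Suc n))"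
    by blast
  also have "\<dots> = (qnum q (real (Suc n)) * q powr real (Suc a) - q powr real (Suc n) * qnum q (real (Suc a)))
       * qmoment q a n"
    unfolding qmoment_Suc_Suc[OF assms] using assms
    by (simp only: powr_realpow left_diff_distrib mult.assoc)
  also have "qnum q (real (Suc n)) * q powr real (Suc a) - q powr real (Suc n) * qnum q (real (Suc a)) =
      qnum q (real (n - a))"
  proof -
    have "real (n - a) = - real (Suc a) + real (Suc n)"
      using assms by (simp add: of_nat_diff)
    then show ?thesis
      using qnum_add[OF assms(1), of "- real (Suc a)" "real (Suc n)"] by (simp add: qnum_minus mult.commute del: of_nat_Suc)
  qed
  finally show ?thesis .
qed

text \<open>A q-analogue of the beta integral. Starting from \<open>qmoment_0_1\<close>, the inner
  induction raises n at order 0, and the outer one raises order and n together.\<close>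

lemma qmoment_eq:
  assumes "q > 0"
  shows "qmoment q a (Suc (a + b)) = qfac q a * qfac q b / qfac q (Suc (a + b)) * (2 / qlog_ratio q)"
proof (induction a)
  case 0
  show ?case
  proof (induction b)
    case 0
    then show ?case
      using qmoment_0_1[OF assms] qnum_1[OF assms] by (simp add: qfac_Suc)
  next
    case (Suc b)
    have pos: "qnum q (real (Suc (Suc b))) > 0" using assms by (intro qnum_pos) auto
    have "qnum q (real (Suc (Suc b))) * qmoment q 0 (Suc (Suc b)) =
      qnum q (real (Suc b)) * qmoment q 0 (Suc b)"
      using qmoment_Suc[OF assms, of 0 "Suc b"] by simp
    also have "\<dots> = qnum q (real (Suc (Suc b))) * (qfac q (Suc b) / qfac q (Suc (Suc b)) * (2 / qlog_ratio q))"
      using Suc pos assms by (simp add: qfac_Suc del: of_nat_Suc)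
    finally have "qmoment q 0 (Suc (Suc b)) = qfac q (Suc b) / qfac q (Suc (Suc b)) * (2 / qlog_ratio q)"
      by (rule mult_left_cancel[OF less_imp_neq[OF pos, symmetric], THEN iffD1])
    then show ?case by simp
  qed
next
  case (Suc a)
  have pos: "qnum q (real (Suc (Suc (a + b)))) > 0" using assms by (intro qnum_pos) auto
  have "qnum q (real (Suc (Suc (a + b)))) * qmoment q (Suc a) (Suc (Suc (a + b))) =
      qnum q (real (Suc a)) * qmoment q a (Suc (a + b))"
    using qmoment_Suc_Suc[OF assms, of a "Suc (a + b)"] by simp
  also have "\<dots> = qnum q (real (Suc (Suc (a + b)))) *
      (qfac q (Suc a) * qfac q b / qfac q (Suc (Suc (a + b))) * (2 / qlog_ratio q))"
    using Suc pos assms by (simp add: qfac_Suc[of _ a] qfac_Suc[of _ "Suc (a + b)"] del: of_nat_Suc)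
  finally have "qmoment q (Suc a) (Suc (Suc (a + b))) =
      qfac q (Suc a) * qfac q b / qfac q (Suc (Suc (a + b))) * (2 / qlog_ratio q)"
    by (rule mult_left_cancel[OF less_imp_neq[OF pos, symmetric], THEN iffD1])
  then show ?case by simp
qed

subsection \<open>The \<open>q\<close>-Vilenkin functions\<close>

text \<open>The infinite shifted factorial of -x with base q^2, meant for 0 < q < 1.\<close>

definition qpoch :: "real \<Rightarrow> real \<Rightarrow> real" where
  "qpoch q x = (\<Prod>k. 1 + q powr (2 * real k) * x)"

lemma convergent_qpoch:
  assumes "0 < q" "q < 1"
  shows "convergent_prod (\<lambda>k. 1 + q powr (2 * real k) * x)"
proof (intro abs_convergent_prod_imp_convergent_prod summable_imp_abs_convergent_prod)
  have "norm (1 + q powr (2 * real k) * x - 1) = (q\<^sup>2) ^ k * \<bar>x\<bar>" for k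
  proof -
    have "q powr (2 * real k) = (q\<^sup>2) ^ k"
      using assms powr_realpow[of q "2 * k"] by (simp add: power_mult)
    then show ?thesis by (simp add: abs_mult)
  qed
  moreover have "summable (\<lambda>k. (q\<^sup>2) ^ k * \<bar>x\<bar>)"
    using assms by (intro summable_mult2 summable_geometric) (simp add: power_less_one_iff)
  ultimately show "summable (\<lambda>k. norm (1 + q powr (2 * real k) * x - 1))"
    by simp
qed

lemma one_plus_powr_pos: "x \<ge> 0 \<Longrightarrow> 1 + q powr e * x > (0 :: real)"
  by (intro add_pos_nonneg mult_nonneg_nonneg) auto

lemma qpoch_nonzero:
  assumes "0 < q" "q < 1" "x \<ge> 0"
  shows "qpoch q x \<noteq> 0"
  unfolding qpoch_def
  by (rule prodinf_nonzero[OF convergent_qpoch[OF assms(1,2)]])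
    (use one_plus_powr_pos[OF assms(3)] in \<open>simp add: less_imp_neq[symmetric]\<close>)

lemma qpoch_split:
  assumes "0 < q" "q < 1" "x \<ge> 0"
  shows "qpoch q x = (\<Prod>k<m. 1 + q powr (2 * real k) * x) * qpoch q (q powr (2 * real m) * x)"
proof -
  have "1 + q powr (2 * real (k + m)) * x = 1 + q powr (2 * real k) * (q powr (2 * real m) * x)" for k
    by (simp add: distrib_left powr_add)
  moreover have "(\<Prod>k. 1 + q powr (2 * real k) * x) =
    (\<Prod>k. 1 + q powr (2 * real (k + m)) * x) * (\<Prod>k<m. 1 + q powr (2 * real k) * x)"
    using one_plus_powr_pos[OF assms(3)]
    by (intro prodinf_split_initial_segment convergent_qpoch assms) (metis less_irrefl)
  ultimately show ?thesis
    unfolding qpoch_def by (simp only: mult.commute)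
qed

lemma vilenkin_Q_less_1:
  assumes "0 < q" "q < 1"
  shows "vilenkin_Q q J y = qpoch q y / qpoch q (q powr (- 2 * J) * y)"
proof -
  have "q powr (- 2 * J + 2 * real k) * y = q powr (2 * real k) * (q powr (- 2 * J) * y)" for k
    by (simp add: mult.assoc[symmetric] flip: powr_add)
  then show ?thesis
    unfolding vilenkin_Q_def if_P[OF assms(2)] qpoch_def
    by (simp only: prodinf_divide[OF convergent_qpoch[OF assms] convergent_qpoch[OF assms]])
qed

text \<open>The branch of \<open>vilenkin_Q\<close> for parameters above 1, taken at
  \<open>inverse q\<close>, becomes a quotient of the same infinite products in
  \<open>q\<close>.\<close>

lemma vilenkin_Q_inverse_less_1:
  assumes "0 < q" "q < 1"
  shows "vilenkin_Q (inverse q) J y = qpoch q (q powr (2 * J + 2) * y) / qpoch q (q powr 2 * y)"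
proof -
  have pw: "inverse q powr x = q powr (- x)" for x
    using assms by (simp add: powr_minus inverse_powr)
  have 1: "inverse q powr (- 2 * J - 2 * real k - 2) * y = q powr (2 * real k) * (q powr (2 * J + 2) * y)" for k
    unfolding pw mult.assoc[symmetric] powr_add[symmetric] by (simp add: algebra_simps)
  have 2: "inverse q powr (- 2 * real k - 2) * y = q powr (2 * real k) * (q powr 2 * y)" for k
    unfolding pw mult.assoc[symmetric] powr_add[symmetric] by (simp add: algebra_simps)
  have "\<not> inverse q < 1" "inverse q \<noteq> 1"
    using one_less_inverse[OF assms] by auto
  then show ?thesis
    unfolding vilenkin_Q_def 1 2 qpoch_def
    by (simp only: prodinf_divide[OF convergent_qpoch[OF assms] convergent_qpoch[OF assms]] if_False)
qed

lemma qweight_inverse: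
  assumes "q > 0"
  shows "qweight (inverse q) n x = qweight q n x"
  unfolding qweight_def
proof (rule prod.reindex_bij_witness[of _ "\<lambda>k. n - k" "\<lambda>k. n - k"])
  fix k assume "k \<in> {..n}"
  then have "2 * real (n - k) - real n = - (2 * real k - real n)"
    by (simp add: of_nat_diff)
  moreover have "inverse q powr (2 * real k - real n) = q powr (- (2 * real k - real n))"
    using assms by (simp only: powr_minus inverse_powr)
  ultimately show "1 + q powr (2 * real (n - k) - real n) * x = 1 + inverse q powr (2 * real k - real n) * x"
    by (simp only:)
qed auto

text \<open>Four infinite products telescope in pairs. The one starting at q^(-2) y exceeds the one
  at q^2 y by two factors, which form the numerator; the one starting at q^(-2J-2) y exceeds the one
  at q^(2J'+2) y by m + 2 factors, which are the weight after centring their exponents.\<close>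

lemma vilenkin_Q_mult_less_1:
  assumes "0 < q" "q < 1" "y > 0" "J + J' = real m"
  shows "vilenkin_Q (inverse q) J' y * vilenkin_Q q J (q powr (- 2) * y) =
    (1 + y) * (1 + q powr (- 2) * y) / qweight q (Suc m) (q powr (J' - J - 1) * y)"
proof -
  have nz: "qpoch q (q powr e * y) \<noteq> 0" for e
    using assms by (intro qpoch_nonzero) auto
  have 1: "qpoch q (q powr (- 2) * y) = (1 + q powr (- 2) * y) * (1 + y) * qpoch q (q powr 2 * y)"
  proof -
    have "q powr (2 * real 1) * (q powr (- 2) * y) = y" "q powr (2 * real 2) * (q powr (- 2) * y) = q powr 2 * y"
      unfolding mult.assoc[symmetric] powr_add[symmetric] using assms by auto
    moreover have "(\<Prod>k<2. 1 + q powr (2 * real k) * z) = (1 + z) * (1 + q powr (2 * real 1) * z)" for z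
    proof -
      have "{..<2} = {0, 1::nat}" by auto
      then show ?thesis using assms by simp
    qed
    moreover have "qpoch q (q powr (- 2) * y) = (\<Prod>k<2. 1 + q powr (2 * real k) * (q powr (- 2) * y)) *
        qpoch q (q powr (2 * real 2) * (q powr (- 2) * y))"
      using assms by (intro qpoch_split) auto
    ultimately show ?thesis by (simp only:)
  qed
  have 2: "qpoch q (q powr (- 2 * J) * (q powr (- 2) * y)) =
    qweight q (Suc m) (q powr (J' - J - 1) * y) * qpoch q (q powr (2 * J' + 2) * y)"
  proof -
    have "q powr (2 * real (Suc (Suc m))) * (q powr (- 2 * J) * (q powr (- 2) * y)) = q powr (2 * J' + 2) * y"
      unfolding mult.assoc[symmetric] powr_add[symmetric] by (simp add: assms(4)[symmetric] algebra_simps)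
    moreover have "q powr (2 * real k) * (q powr (- 2 * J) * (q powr (- 2) * y)) =
        q powr (2 * real k - real (Suc m)) * (q powr (J' - J - 1) * y)" for k
      unfolding mult.assoc[symmetric] powr_add[symmetric] by (simp add: assms(4)[symmetric] algebra_simps)
    ultimately show ?thesis
      using qpoch_split[of q "q powr (- 2 * J) * (q powr (- 2) * y)" "Suc (Suc m)"] assms
      unfolding qweight_def lessThan_Suc_atMost by (simp only:) simp
  qed
  have "qweight q (Suc m) (q powr (J' - J - 1) * y) \<noteq> 0"
    using 2 nz[of "- 2 * J - 2"] unfolding mult.assoc[symmetric] powr_add[symmetric] by auto
  then show ?thesis
    unfolding vilenkin_Q_less_1[OF assms(1,2)] vilenkin_Q_inverse_less_1[OF assms(1,2)] 1 2
    using nz[of 2] nz[of "2 * J' + 2"] by (simp add: divide_simps)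
qed

lemma vilenkin_Q_mult:
  assumes "0 < q" "y > 0" "J + J' = real m"
  shows "vilenkin_Q (inverse q) J' y * vilenkin_Q q J (q powr (- 2) * y) =
    (1 + y) * (1 + q powr (- 2) * y) / qweight q (Suc m) (q powr (J' - J - 1) * y)"
proof -
  consider "q < 1" | "q = 1" | "q > 1" by linarith
  then show ?thesis
  proof cases
    case 1
    then show ?thesis using assms by (intro vilenkin_Q_mult_less_1)
  next
    case 2
    have "- J' + - J = - real m" using assms by simp
    then have "(1 + y) powr (- J') * (1 + y) powr (- J) = (1 + y) powr (- real m)"
      by (simp only: powr_add[symmetric])
    also have "\<dots> = 1 / (1 + y) ^ m"
      using assms by (simp add: powr_minus_divide powr_realpow)
    finally have "vilenkin_Q 1 J' y * vilenkin_Q 1 J y = 1 / (1 + y) ^ m"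
      by (simp add: vilenkin_Q_def)
    then show ?thesis
      using assms by (simp add: 2 qweight_1)
  next
    case 3
    define p where "p = inverse q"
    have p: "0 < p" "p < 1" "inverse p = q"
      using 3 by (auto simp: p_def inverse_less_1_iff)
    have pw: "p powr x = q powr (- x)" for x
      using assms by (simp add: p_def powr_minus inverse_powr)
    have y: "p powr (- 2) * (q powr (- 2) * y) = y"
      unfolding pw mult.assoc[symmetric] powr_add[symmetric] using assms by simp
    have s: "p powr (J - J' - 1) * (q powr (- 2) * y) = q powr (J' - J - 1) * y"
      unfolding pw mult.assoc[symmetric] powr_add[symmetric] by simp
    \<comment> \<open>The case below 1 is applied to p = 1/q with J and J' exchanged and with q^(-2)
      y as the base point, whose p-shift is y again.\<close>
    have "vilenkin_Q (inverse p) J (q powr (- 2) * y) * vilenkin_Q p J' (p powr (- 2) * (q powr (- 2) * y)) =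
      (1 + q powr (- 2) * y) * (1 + p powr (- 2) * (q powr (- 2) * y)) /
        qweight p (Suc m) (p powr (J - J' - 1) * (q powr (- 2) * y))"
      using assms p by (intro vilenkin_Q_mult_less_1) auto
    moreover have "qweight p (Suc m) x = qweight q (Suc m) x" for x
      unfolding p_def using assms by (intro qweight_inverse)
    ultimately show ?thesis
      unfolding y s p(3) by (simp add: p_def mult.commute)
  qed
qed

section \<open>The polynomial factor and the symmetries in M and N\<close>

lemma vilenkin_R_eq:
  assumes "J - M = real a" "J - N = real b" "M + N = real c" "a \<le> b"
  shows "vilenkin_R q J M N y =
    qfac q a * qfac q b * (\<Sum>k\<le>a. (- y) ^ k / (qfac q k * qfac q (a - k) * qfac q (b - k) * qfac q (c + k)))"
proof -
  have "(\<Sum>k\<in>{k::int. 0 \<le> k \<and> 0 \<le> J - M - of_int k \<and> 0 \<le> J - N - of_int k \<and> 0 \<le> M + N + of_int k}.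
       (- y) powi k / (qfact q (of_int k) * qfact q (J - M - of_int k) * qfact q (J - N - of_int k) *
        qfact q (M + N + of_int k))) =
    (\<Sum>k\<le>a. (- y) ^ k / (qfac q k * qfac q (a - k) * qfac q (b - k) * qfac q (c + k)))"
    unfolding assms(1-3)
  \<comment> \<open>Since a <= b and c >= 0, the index set is exactly the integers from 0 to
    a.\<close>
  proof (rule sum.reindex_bij_witness[of _ int nat])
    fix k :: int
    assume k: "k \<in> {k. 0 \<le> k \<and> 0 \<le> real a - of_int k \<and> 0 \<le> real b - of_int k \<and> 0 \<le> real c + of_int k}"
    then have "real_of_int k \<le> real_of_int (int a)" by simp
    then have ka: "k \<le> int a" by (simp only: of_int_le_iff)
    with k show "int (nat k) = k" "nat k \<in> {..a}" by auto
    have "real_of_int k = real (nat k)" "real a - of_int k = real (a - nat k)"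
      "real b - of_int k = real (b - nat k)" "real c + of_int k = real (c + nat k)"
      using k ka assms(4) by (auto simp: of_nat_diff nat_le_iff)
    moreover have "(- y) powi k = (- y) ^ nat k"
      using k by (simp add: power_int_def)
    ultimately show "(- y) ^ nat k / (qfac q (nat k) * qfac q (a - nat k) * qfac q (b - nat k) * qfac q (c + nat k)) =
       (- y) powi k / (qfact q (of_int k) * qfact q (real a - of_int k) * qfact q (real b - of_int k) *
        qfact q (real c + of_int k))"
      by (simp only: qfact_real)
  qed (use assms in auto)
  then show ?thesis
    unfolding vilenkin_R_def by (simp add: assms(1,2) qfact_real)
qed

text \<open>With M + N replaced by -c the sum starts at index c. Shifting by c permutes the four
  factorials of \<open>vilenkin_R_eq\<close>, so the two polynomials agree up to prefactors and the
  power (-y)^c.\<close>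

lemma vilenkin_R_neg_eq:
  assumes "J - M = real a" "J - N = real b" "M + N = real c" "a \<le> b"
  shows "vilenkin_R q J (- N) (- M) y =
    qfac q (a + c) * qfac q (b + c) *
      (\<Sum>k\<le>a. (- y) ^ (c + k) / (qfac q k * qfac q (a - k) * qfac q (b - k) * qfac q (c + k)))"
proof -
  have e: "J - - N = real (a + c)" "J - - M = real (b + c)" "- N + - M = - real c"
    using assms by auto
  have "(\<Sum>k\<in>{k::int. 0 \<le> k \<and> 0 \<le> J - - N - of_int k \<and> 0 \<le> J - - M - of_int k \<and> 0 \<le> - N + - M + of_int k}.
       (- y) powi k / (qfact q (of_int k) * qfact q (J - - N - of_int k) * qfact q (J - - M - of_int k) *
        qfact q (- N + - M + of_int k))) =
    (\<Sum>k\<le>a. (- y) ^ (c + k) / (qfac q k * qfac q (a - k) * qfac q (b - k) * qfac q (c + k)))"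
    unfolding e
  proof (rule sum.reindex_bij_witness[of _ "\<lambda>k. int (c + k)" "\<lambda>k. nat k - c"])
    fix k :: int
    assume k: "k \<in> {k. 0 \<le> k \<and> 0 \<le> real (a + c) - of_int k \<and> 0 \<le> real (b + c) - of_int k \<and> 0 \<le> - real c + of_int k}"
    then have "real_of_int k \<le> real_of_int (int (a + c))" "real_of_int k \<ge> real_of_int (int c)" by auto
    then have ka: "k \<le> int (a + c)" "k \<ge> int c" by (simp_all only: of_int_le_iff)
    then obtain j where j: "k = int (c + j)" "j \<le> a"
      by (metis add_le_cancel_left nat_int_comparison(3) add.commute nonneg_int_cases le_Suc_ex of_nat_0_le_iff order_trans of_nat_le_iff)
    then show "int (c + (nat k - c)) = k" "nat k - c \<in> {..a}" by auto
    have "real_of_int k = real (c + j)" "real (a + c) - of_int k = real (a - j)"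
      "real (b + c) - of_int k = real (b - j)" "- real c + of_int k = real j"
      using j assms(4) by (auto simp: of_nat_diff)
    moreover have "(- y) powi k = (- y) ^ (c + j)"
      unfolding j(1) by (rule power_int_of_nat)
    moreover have "nat k - c = j"
      using j by simp
    ultimately show "(- y) ^ (c + (nat k - c)) / (qfac q (nat k - c) * qfac q (a - (nat k - c)) *
        qfac q (b - (nat k - c)) * qfac q (c + (nat k - c))) =
       (- y) powi k / (qfact q (of_int k) * qfact q (real (a + c) - of_int k) * qfact q (real (b + c) - of_int k) *
        qfact q (- real c + of_int k))"
      by (simp only: qfact_real mult_ac)
  qed (use assms in auto)
  then show ?thesis
    unfolding vilenkin_R_def unfolding e qfact_real by (simp add: mult_ac)
qed

lemma vilenkin_P_commute: "vilenkin_P q J M N \<xi> = vilenkin_P q J N M \<xi>"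
proof -
  have "vilenkin_R q J M N y = vilenkin_R q J N M y" for y
    unfolding vilenkin_R_def mult.commute[of "qfact q (J - N)"]
    by (intro refl arg_cong2[where f = "(*)"] sum.cong) (auto simp: mult_ac add.commute)
  moreover have "2 * J - M - N = 2 * J - N - M" by simp
  ultimately show ?thesis
    unfolding vilenkin_P_def by (simp only: mult.commute add.commute)
qed

text \<open>Three discrepancies balance: the inverted square root is compensated by the changed
  factorial prefactor of R, y^(-c/2) (-y)^c equals (-1)^c y^(c/2), and that sign is absorbed by the
  extra phase i^(2c).\<close>

lemma vilenkin_P_uminus:
  assumes "q > 0" "J - M = real a" "J - N = real b" "M + N = real c" "a \<le> b" "\<xi> \<in> {-1<..<1}"
  shows "vilenkin_P q J (- N) (- M) \<xi> = vilenkin_P q J M N \<xi>"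
proof -
  define y where "y = eta_of \<xi>"
  have y: "y > 0" using assms(6) by (auto simp: y_def eta_of_def)
  define S where "S = (\<Sum>k\<le>a. (- y) ^ k / (qfac q k * qfac q (a - k) * qfac q (b - k) * qfac q (c + k)))"
  define A B where "A = qfac q (a + c) * qfac q (b + c)" and "B = qfac q a * qfac q b"
  have pos: "A > 0" "B > 0" using assms(1) by (auto simp: A_def B_def intro!: mult_pos_pos qfac_pos)
  have sq: "sqrt (B / A) * A = sqrt (A / B) * B"
    using pos by (simp add: real_sqrt_divide field_simps)
  have 1: "J + M = real (b + c)" "J + N = real (a + c)" "J + - N = real b" "J + - M = real a"
    "J - - N = real (a + c)" "J - - M = real (b + c)"
    using assms by auto
  have "2 * J - M - N = of_int (int (a + b))" "2 * J - - N - - M = of_int (int (a + b + 2 * c))"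
    using assms by auto
  then have 2: "\<lfloor>2 * J - M - N\<rfloor> = int (a + b)" "\<lfloor>2 * J - - N - - M\<rfloor> = int (a + b + 2 * c)"
    by (simp_all only: floor_of_int)
  have "\<i> ^ (a + b + 2 * c) = \<i> ^ (a + b) * of_real ((- 1) ^ c)"
    by (simp add: power_add power_mult)
  then have i: "\<i> powi int (a + b + 2 * c) = \<i> powi int (a + b) * of_real ((- 1) ^ c)"
    by (simp only: power_int_of_nat)
  have "(- y) ^ c * y powr (- (real c / 2)) = (- 1) ^ c * (y powr real c * y powr (- (real c / 2)))"
    using y by (subst power_minus) (simp add: powr_realpow)
  also have "\<dots> = (- 1) ^ c * y powr (real c / 2)"
    by (simp flip: powr_add)
  finally have p: "y powr (- (real c / 2)) * (- y) ^ c = (- 1) ^ c * y powr (real c / 2)"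
    by (simp add: mult.commute)
  have S': "(\<Sum>k\<le>a. (- y) ^ (c + k) / (qfac q k * qfac q (a - k) * qfac q (b - k) * qfac q (c + k))) = (- y) ^ c * S"
    by (simp add: S_def power_add sum_distrib_left)
  have e: "(- N + - M) / 2 = - (real c / 2)" "(M + N) / 2 = real c / 2" using assms by auto
  have "(- 1) ^ c * (sqrt (B / A) * y powr (- (real c / 2)) * vilenkin_Q q J y * (A * ((- y) ^ c * S))) =
    (- 1) ^ c * (sqrt (B / A) * A * (y powr (- (real c / 2)) * (- y) ^ c) * vilenkin_Q q J y * S)"
    by (simp only: mult_ac)
  also have "\<dots> = ((- 1) ^ c * (- 1) ^ c) * (sqrt (A / B) * B * y powr (real c / 2) * vilenkin_Q q J y * S)"
    unfolding sq p by (simp only: mult_ac)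
  also have "\<dots> = sqrt (A / B) * y powr (real c / 2) * vilenkin_Q q J y * (B * S)"
    by (simp flip: power_mult_distrib)
  finally have main: "(- 1) ^ c * (sqrt (B / A) * y powr (- (real c / 2)) * vilenkin_Q q J y * (A * ((- y) ^ c * S))) =
    sqrt (A / B) * y powr (real c / 2) * vilenkin_Q q J y * (B * S)" .
  have "vilenkin_P q J (- N) (- M) \<xi> = \<i> powi int (a + b) * of_real ((- 1) ^ c *
     (sqrt (B / A) * y powr (- (real c / 2)) * vilenkin_Q q J y * (A * ((- y) ^ c * S))))"
    unfolding vilenkin_P_def 2 i e y_def[symmetric] vilenkin_R_neg_eq[OF assms(2-5)] S' 1 qfact_real
      of_real_mult A_def B_def by (simp add: mult_ac)
  also have "\<dots> = vilenkin_P q J M N \<xi>"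
    unfolding main unfolding vilenkin_P_def 2 e y_def[symmetric] vilenkin_R_eq[OF assms(2-5)] S_def
      1 qfact_real assms(2,3) A_def B_def by (simp add: mult_ac)
  finally show ?thesis .
qed

subsection \<open>The orthonormality integral\<close>

lemma eta_of_pos: "\<xi> \<in> {-1<..<1} \<Longrightarrow> eta_of \<xi> > 0"
  by (auto simp: eta_of_def)

lemma eta_of_xi_of: "y > 0 \<Longrightarrow> eta_of (xi_of y) = y"
  by (simp add: eta_of_def xi_of_def field_simps)

lemma xi_of_in: "y > 0 \<Longrightarrow> xi_of y \<in> {-1<..<1}"
  by (simp add: xi_of_def field_simps)

lemma xi_of_eta_of: "\<xi> \<in> {-1<..<1} \<Longrightarrow> xi_of (eta_of \<xi>) = \<xi>"
  by (simp add: eta_of_def xi_of_def field_simps)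

lemma eta_of_has_derivative:
  "\<xi> \<in> {-1<..<1} \<Longrightarrow> (eta_of has_real_derivative 2 / (1 - \<xi>)\<^sup>2) (at \<xi> within S)"
  unfolding eta_of_def [abs_def]
  by (auto intro!: derivative_eq_intros simp: power2_eq_square field_simps)

text \<open>The substitution s = c eta, whose Jacobian is c times 2/(1-\<xi>)^2.\<close>

lemma has_integral_eta_of_scaled:
  assumes "c > 0" "f absolutely_integrable_on {0<..}" "(f has_integral I) {0<..}"
  shows "((\<lambda>\<xi>. c * (2 / (1 - \<xi>)\<^sup>2) * f (c * eta_of \<xi>)) has_integral I) {-1<..<1}"
proof -
  have im: "(\<lambda>\<xi>. c * eta_of \<xi>) ` {-1<..<1} = {0<..}"
  proof (intro equalityI subsetI)
    fix y :: real assume "y \<in> {0<..}"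
    then show "y \<in> (\<lambda>\<xi>. c * eta_of \<xi>) ` {-1<..<1}"
      using assms(1) xi_of_in[of "y / c"] eta_of_xi_of[of "y / c"]
      by (intro image_eqI[of _ _ "xi_of (y / c)"]) auto
  qed (use assms(1) eta_of_pos in auto)
  have inj: "inj_on (\<lambda>\<xi>. c * eta_of \<xi>) {-1<..<1}"
    using assms(1) by (intro inj_onI) (metis mult_left_cancel less_irrefl xi_of_eta_of)
  have der: "((\<lambda>\<xi>. c * eta_of \<xi>) has_real_derivative c * (2 / (1 - \<xi>)\<^sup>2)) (at \<xi> within {-1<..<1})"
    if "\<xi> \<in> {-1<..<1}" for \<xi>
    using eta_of_has_derivative[OF that] by (rule DERIV_cmult)
  have "f absolutely_integrable_on (\<lambda>\<xi>. c * eta_of \<xi>) ` {-1<..<1} \<and>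
      integral ((\<lambda>\<xi>. c * eta_of \<xi>) ` {-1<..<1}) f = I"
    unfolding im using assms by (simp add: integral_unique)
  then have *: "(\<lambda>\<xi>. \<bar>c * (2 / (1 - \<xi>)\<^sup>2)\<bar> * f (c * eta_of \<xi>)) absolutely_integrable_on {-1<..<1} \<and>
      integral {-1<..<1} (\<lambda>\<xi>. \<bar>c * (2 / (1 - \<xi>)\<^sup>2)\<bar> * f (c * eta_of \<xi>)) = I"
    by (subst has_absolute_integral_change_of_variables_1'[OF _ der inj]) auto
  have "\<bar>c * (2 / (1 - \<xi>)\<^sup>2)\<bar> = c * (2 / (1 - \<xi>)\<^sup>2)" for \<xi>
    using assms(1) by simp
  with * show ?thesis
    by (simp only: has_integral_iff set_lebesgue_integral_eq_integral(1))
qed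

section \<open>Reduction of one term of the integrand to a rational kernel\<close>

definition vilenkin_term :: "real \<Rightarrow> real \<Rightarrow> real \<Rightarrow> real \<Rightarrow> real \<Rightarrow> real \<Rightarrow> complex" where
  "vilenkin_term q J' J M N \<xi> = cnj (vilenkin_P (inverse q) J' M N \<xi>) *
     complex_of_real (1 / (q + inverse q - (q - inverse q) * \<xi>)) * qshift q 1 (vilenkin_P q J M N) \<xi>"

text \<open>The first term of the integrand in the variable \<open>s\<close>, without its constant factors.\<close>

definition vilenkin_kernel :: "real \<Rightarrow> nat \<Rightarrow> nat \<Rightarrow> nat \<Rightarrow> nat \<Rightarrow> nat \<Rightarrow> real \<Rightarrow> real" where
  "vilenkin_kernel q a' b' a b c s = (\<Sum>k\<le>a'. \<Sum>l\<le>a.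
     ((- 1) ^ (k + l) *
     q powr ((real a - real a') * (real c + 1) + real k * (real a - real a' + 1) +
       real l * (real a - real a' - 1)) /
     (qfac q k * qfac q (a' - k) * qfac q (b' - k) * qfac q (c + k) *
      (qfac q l * qfac q (a - l) * qfac q (b - l) * qfac q (c + l)))) *
     (s ^ (c + k + l) / qweight q (Suc (a + b' + c)) s))"

lemma vilenkin_kernel_integrable:
  assumes "q > 0" "a' \<le> b'"
  shows "vilenkin_kernel q a' b' a b c absolutely_integrable_on {0<..}"
  unfolding vilenkin_kernel_def [abs_def]
  using assms
  by (intro absolutely_integrable_sum set_integrable_mult_right absolutely_integrable_qweight) auto

lemma vilenkin_kernel_has_integral:
  assumes "q > 0" "a' \<le> b'"
  shows "(vilenkin_kernel q a' b' a b c has_integral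
    vilenkin_sum q a' b' a b c / qfac q (Suc (a + b' + c)) * (2 / qlog_ratio q)) {0<..}"
proof -
  have "(vilenkin_kernel q a' b' a b c has_integral (\<Sum>k\<le>a'. \<Sum>l\<le>a.
     ((- 1) ^ (k + l) *
     q powr ((real a - real a') * (real c + 1) + real k * (real a - real a' + 1) +
       real l * (real a - real a' - 1)) /
     (qfac q k * qfac q (a' - k) * qfac q (b' - k) * qfac q (c + k) *
      (qfac q l * qfac q (a - l) * qfac q (b - l) * qfac q (c + l)))) *
     qmoment q (c + k + l) (Suc (a + b' + c)))) {0<..}"
    unfolding vilenkin_kernel_def [abs_def] using assms
    by (intro has_integral_sum has_integral_mult_right qmoment_has_integral) auto
  also have "(\<Sum>k\<le>a'. \<Sum>l\<le>a.
     ((- 1) ^ (k + l) *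
     q powr ((real a - real a') * (real c + 1) + real k * (real a - real a' + 1) +
       real l * (real a - real a' - 1)) /
     (qfac q k * qfac q (a' - k) * qfac q (b' - k) * qfac q (c + k) *
      (qfac q l * qfac q (a - l) * qfac q (b - l) * qfac q (c + l)))) *
     qmoment q (c + k + l) (Suc (a + b' + c))) =
    vilenkin_sum q a' b' a b c / qfac q (Suc (a + b' + c)) * (2 / qlog_ratio q)"
    unfolding vilenkin_sum_def sum_distrib_right sum_divide_distrib
  proof (intro sum.cong refl)
    fix k l assume "k \<in> {..a'}" "l \<in> {..a}"
    \<comment> \<open>The natural subtraction is exact because k <= a' <= b' and l <= a, so
      \<open>qmoment_eq\<close> applies.\<close>
    then have e: "c + k + l + (a + b' - k - l) = a + b' + c"
      using assms by auto
    then have m: "qmoment q (c + k + l) (Suc (a + b' + c)) =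
        qfac q (c + k + l) * qfac q (a + b' - k - l) / qfac q (Suc (a + b' + c)) * (2 / qlog_ratio q)"
      using qmoment_eq[OF assms(1), of "c + k + l" "a + b' - k - l"] by (simp only: e)
    show "(- 1) ^ (k + l) *
     q powr ((real a - real a') * (real c + 1) + real k * (real a - real a' + 1) +
       real l * (real a - real a' - 1)) /
     (qfac q k * qfac q (a' - k) * qfac q (b' - k) * qfac q (c + k) *
      (qfac q l * qfac q (a - l) * qfac q (b - l) * qfac q (c + l))) *
     qmoment q (c + k + l) (Suc (a + b' + c)) =
     (- 1) ^ (k + l) *
     q powr ((real a - real a') * (real c + 1) + real k * (real a - real a' + 1) +
       real l * (real a - real a' - 1)) *
     (qfac q (c + k + l) * qfac q (a + b' - k - l)) /
     (qfac q k * qfac q (a' - k) * qfac q (b' - k) * qfac q (c + k) *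
      (qfac q l * qfac q (a - l) * qfac q (b - l) * qfac q (c + l))) /
     qfac q (Suc (a + b' + c)) * (2 / qlog_ratio q)"
      unfolding m by (simp only: times_divide_eq_left times_divide_eq_right mult_ac divide_divide_eq_left)
  qed
  finally show ?thesis .
qed

text \<open>The square root from \<open>vilenkin_P\<close> combined with the factorial prefactor of
  \<open>vilenkin_R\<close>, with J + M = b + c and J + N = a + c.\<close>

definition vilenkin_norm :: "real \<Rightarrow> nat \<Rightarrow> nat \<Rightarrow> nat \<Rightarrow> real" where
  "vilenkin_norm q a b c = sqrt (qfac q (b + c) * qfac q (a + c) / (qfac q a * qfac q b)) * (qfac q a * qfac q b)"

lemma vilenkin_P_eq:
  assumes "q > 0" "J - M = real a" "J - N = real b" "M + N = real c" "a \<le> b"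
  shows "vilenkin_P q J M N \<xi> = \<i> ^ (a + b) * complex_of_real (vilenkin_norm q a b c *
    (eta_of \<xi> powr (real c / 2) * vilenkin_Q q J (eta_of \<xi>) *
      (\<Sum>k\<le>a. (- eta_of \<xi>) ^ k / (qfac q k * qfac q (a - k) * qfac q (b - k) * qfac q (c + k)))))"
proof -
  have 1: "J + M = real (b + c)" "J + N = real (a + c)" "(M + N) / 2 = real c / 2"
    using assms by auto
  have "2 * J - M - N = of_int (int (a + b))"
    using assms by auto
  then have 2: "\<lfloor>2 * J - M - N\<rfloor> = int (a + b)"
    by (simp only: floor_of_int)
  show ?thesis
    unfolding vilenkin_P_def 1 2 vilenkin_R_eq[OF assms(2-5)] assms(2,3) qfact_real power_int_of_nat vilenkin_norm_def
    by (simp only: mult_ac)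
qed

lemma powr_half_mult_shifted:
  assumes "q > 0" "y > 0"
  shows "y powr (real c / 2) * (q powr (- 2) * y) powr (real c / 2) = q powr (- real c) * y ^ c"
proof -
  have "y powr (real c / 2) * (q powr (- 2) * y) powr (real c / 2) =
      (q powr (- 2)) powr (real c / 2) * (y powr (real c / 2) * y powr (real c / 2))"
    using assms by (subst powr_mult) auto
  also have "\<dots> = q powr (- real c) * y ^ c"
    using assms by (simp add: powr_powr powr_realpow flip: powr_add)
  finally show ?thesis .
qed

text \<open>This explains the exponent in the kernel: at s = q^(a'-a-1) y, together with the
  Jacobian factor, the powers of \<open>q\<close> collapse to q^(-1-c-2l). There q^(-2l) is the
  shift in the second polynomial and q^(-c) comes from the shifted power of eta.\<close>

lemma vilenkin_kernel_shifted:
  assumes "q > 0" "y > 0"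
  shows "q powr (real a' - real a - 1) * vilenkin_kernel q a' b' a b c (q powr (real a' - real a - 1) * y) =
    q powr (- 1) * (q powr (- real c) * y ^ c) *
     ((\<Sum>k\<le>a'. (- y) ^ k / (qfac q k * qfac q (a' - k) * qfac q (b' - k) * qfac q (c + k))) *
      (\<Sum>l\<le>a. (- (q powr (- 2) * y)) ^ l / (qfac q l * qfac q (a - l) * qfac q (b - l) * qfac q (c + l)))) /
     qweight q (Suc (a + b' + c)) (q powr (real a' - real a - 1) * y)"
  unfolding vilenkin_kernel_def sum_product unfolding sum_distrib_left sum_divide_distrib
proof (intro sum.cong refl)
  fix k l
  let ?d = "real a' - real a - 1"
  let ?W = "qweight q (Suc (a + b' + c)) (q powr ?d * y)"
  let ?B = "qfac q k * qfac q (a' - k) * qfac q (b' - k) * qfac q (c + k)"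
  let ?C = "qfac q l * qfac q (a - l) * qfac q (b - l) * qfac q (c + l)"
  let ?E = "(real a - real a') * (real c + 1) + real k * (real a - real a' + 1) +
       real l * (real a - real a' - 1)"
  have pw: "(q powr e) ^ n = q powr (e * real n)" for e n
    using assms by (simp add: powr_realpow[symmetric] powr_powr)
  have "q powr ?d * q powr ?E * (q powr ?d * y) ^ (c + k + l) =
      (q powr ?d * q powr ?E * q powr (?d * real (c + k + l))) * y ^ (c + k + l)"
    by (simp add: power_mult_distrib pw)
  also have "q powr ?d * q powr ?E * q powr (?d * real (c + k + l)) =
      q powr (- 1) * q powr (- real c) * q powr (- 2 * real l)"
    unfolding powr_add[symmetric] by (simp add: algebra_simps)
  also have "\<dots> * y ^ (c + k + l) = q powr (- 1) * (q powr (- real c) * y ^ c) * y ^ k * (q powr (- 2) * y) ^ l"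
    by (simp add: power_mult_distrib pw power_add)
  finally have *: "q powr ?d * q powr ?E * (q powr ?d * y) ^ (c + k + l) =
    q powr (- 1) * (q powr (- real c) * y ^ c) * y ^ k * (q powr (- 2) * y) ^ l" .
  have "q powr ?d * ((- 1) ^ (k + l) * q powr ?E / (?B * ?C) * ((q powr ?d * y) ^ (c + k + l) / ?W)) =
    (q powr ?d * q powr ?E * (q powr ?d * y) ^ (c + k + l)) * ((- 1) ^ k * (- 1) ^ l) / (?B * ?C * ?W)"
    by (simp add: power_add mult_ac)
  also have "\<dots> = q powr (- 1) * (q powr (- real c) * y ^ c) *
     (((- 1) ^ k * y ^ k) / ?B * (((- 1) ^ l * (q powr (- 2) * y) ^ l) / ?C)) / ?W"
    unfolding * by (simp add: mult_ac)
  also have "\<dots> = q powr (- 1) * (q powr (- real c) * y ^ c) *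
     ((- y) ^ k / ?B * ((- (q powr (- 2) * y)) ^ l / ?C)) / ?W"
    by (simp only: power_minus[of y] power_minus[of "q powr (- 2) * y"])
  finally show "q powr ?d * ((- 1) ^ (k + l) * q powr ?E / (?B * ?C) * ((q powr ?d * y) ^ (c + k + l) / ?W)) =
    q powr (- 1) * (q powr (- real c) * y ^ c) *
     ((- y) ^ k / ?B * ((- (q powr (- 2) * y)) ^ l / ?C)) / ?W" .
qed

lemma vilenkin_norm_inverse: "q > 0 \<Longrightarrow> vilenkin_norm (inverse q) a b c = vilenkin_norm q a b c"
  by (simp add: vilenkin_norm_def qfac_inverse)

text \<open>The infinite products collapse by \<open>vilenkin_Q_mult\<close>, the rational factor
  absorbs their numerator, and what remains is the kernel times the Jacobian of s = q^(a'-a-1)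
  eta.\<close>

lemma vilenkin_term_eq:
  assumes "q > 0" "J - M = real a" "J - N = real b" "J' - M = real a'" "J' - N = real b'"
    and "M + N = real c" "a \<le> b" "a' \<le> b'" "\<xi> \<in> {-1<..<1}"
  shows "vilenkin_term q J' J M N \<xi> = cnj (\<i> ^ (a' + b')) * \<i> ^ (a + b) *
    complex_of_real (vilenkin_norm q a' b' c * vilenkin_norm q a b c *
      (q powr (real a' - real a - 1) * (2 / (1 - \<xi>)\<^sup>2) *
       vilenkin_kernel q a' b' a b c (q powr (real a' - real a - 1) * eta_of \<xi>)))"
proof -
  define y where "y = eta_of \<xi>"
  define z where "z = q powr (- 2) * y"
  define T where "T = 1 / (q + inverse q - (q - inverse q) * \<xi>)"
  define W where "W = qweight q (Suc (a + b' + c)) (q powr (real a' - real a - 1) * y)"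
  define S' where "S' = (\<Sum>k\<le>a'. (- y) ^ k / (qfac q k * qfac q (a' - k) * qfac q (b' - k) * qfac q (c + k)))"
  define S where "S = (\<Sum>l\<le>a. (- z) ^ l / (qfac q l * qfac q (a - l) * qfac q (b - l) * qfac q (c + l)))"
  have y: "y > 0" using eta_of_pos[OF assms(9)] by (simp add: y_def)
  have z: "z > 0" using y assms(1) by (simp add: z_def)
  have "J + J' = real (a + b' + c)" "J' - J - 1 = real a' - real a - 1"
    using assms by auto
  from vilenkin_Q_mult[OF assms(1) y this(1)] this(2)
  have Q: "vilenkin_Q (inverse q) J' y * vilenkin_Q q J z = (1 + y) * (1 + z) / W"
    by (simp only: W_def z_def)
  \<comment> \<open>This is where the denominators in the integrand come from: up to 1/q, they turn
    (1+y)(1+z) into the Jacobian of eta.\<close>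
  have T: "T * ((1 + y) * (1 + z)) = q powr (- 1) * (2 / (1 - \<xi>)\<^sup>2)"
  proof -
    have \<xi>: "1 - \<xi> > 0" "1 + \<xi> > 0" using assms(9) by auto
    define D where "D = q\<^sup>2 * (1 - \<xi>) + (1 + \<xi>)"
    have D: "D > 0" using \<xi> assms(1) by (simp add: D_def add_pos_pos)
    have "q + inverse q - (q - inverse q) * \<xi> = D / q"
      using assms(1) by (simp add: D_def field_simps power2_eq_square)
    then have "T = q / D" by (simp add: T_def)
    moreover have "1 + y = 2 / (1 - \<xi>)"
      using \<xi> by (simp add: y_def eta_of_def field_simps)
    moreover have "1 + z = D / (q\<^sup>2 * (1 - \<xi>))"
      using \<xi> assms(1) by (simp add: z_def y_def eta_of_def D_def powr_minus field_simps)
    ultimately have "T * ((1 + y) * (1 + z)) = q / D * (2 / (1 - \<xi>) * (D / (q\<^sup>2 * (1 - \<xi>))))"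
      by (simp only:)
    also have "\<dots> = q powr (- 1) * (2 / (1 - \<xi>)\<^sup>2)"
      using D \<xi> assms(1) by (simp add: powr_minus power2_eq_square divide_simps)
    finally show ?thesis .
  qed
  have P': "vilenkin_P (inverse q) J' M N \<xi> = \<i> ^ (a' + b') * complex_of_real (vilenkin_norm q a' b' c *
    (y powr (real c / 2) * vilenkin_Q (inverse q) J' y * S'))"
    using assms vilenkin_P_eq[of "inverse q" J' M a' N b' c \<xi>]
    by (simp add: qfac_inverse vilenkin_norm_inverse y_def S'_def)
  have "eta_of (xi_of z) = z" using z by (rule eta_of_xi_of)
  then have P: "qshift q 1 (vilenkin_P q J M N) \<xi> = \<i> ^ (a + b) * complex_of_real (vilenkin_norm q a b c *
    (z powr (real c / 2) * vilenkin_Q q J z * S))"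
    using assms vilenkin_P_eq[of q J M a N b c "xi_of z"]
    by (simp add: qshift_def y_def z_def S_def)
  have "(y powr (real c / 2) * vilenkin_Q (inverse q) J' y * S') * T * (z powr (real c / 2) * vilenkin_Q q J z * S) =
    (y powr (real c / 2) * z powr (real c / 2)) * (T * (vilenkin_Q (inverse q) J' y * vilenkin_Q q J z)) * (S' * S)"
    by (simp only: mult_ac)
  also have "T * (vilenkin_Q (inverse q) J' y * vilenkin_Q q J z) = q powr (- 1) * (2 / (1 - \<xi>)\<^sup>2) / W"
    unfolding Q T[symmetric] by simp
  also have "y powr (real c / 2) * z powr (real c / 2) = q powr (- real c) * y ^ c"
    unfolding z_def using assms(1) y by (rule powr_half_mult_shifted)
  also have "(q powr (- real c) * y ^ c) * (q powr (- 1) * (2 / (1 - \<xi>)\<^sup>2) / W) * (S' * S) =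
    (2 / (1 - \<xi>)\<^sup>2) * (q powr (- 1) * (q powr (- real c) * y ^ c) * (S' * S) / W)"
    by (simp only: times_divide_eq_left times_divide_eq_right mult_ac)
  also have "q powr (- 1) * (q powr (- real c) * y ^ c) * (S' * S) / W =
     q powr (real a' - real a - 1) * vilenkin_kernel q a' b' a b c (q powr (real a' - real a - 1) * y)"
    unfolding vilenkin_kernel_shifted[OF assms(1) y] S_def S'_def W_def z_def ..
  finally have main: "(y powr (real c / 2) * vilenkin_Q (inverse q) J' y * S') * T *
      (z powr (real c / 2) * vilenkin_Q q J z * S) =
    q powr (real a' - real a - 1) * (2 / (1 - \<xi>)\<^sup>2) *
       vilenkin_kernel q a' b' a b c (q powr (real a' - real a - 1) * y)"
    by (simp only: mult_ac)
  have "vilenkin_term q J' J M N \<xi> = cnj (\<i> ^ (a' + b')) * \<i> ^ (a + b) *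
    complex_of_real (vilenkin_norm q a' b' c * vilenkin_norm q a b c *
     ((y powr (real c / 2) * vilenkin_Q (inverse q) J' y * S') * T *
      (z powr (real c / 2) * vilenkin_Q q J z * S)))"
    unfolding vilenkin_term_def P P' T_def[symmetric] complex_cnj_mult complex_cnj_complex_of_real of_real_mult
    by (simp only: mult_ac)
  then show ?thesis
    unfolding main unfolding y_def .
qed

lemma vilenkin_term_has_integral:
  assumes "q > 0" "J - M = real a" "J - N = real b" "J' - M = real a'" "J' - N = real b'"
    and "M + N = real c" "a \<le> b" "a' \<le> b'"
  shows "(vilenkin_term q J' J M N has_integral cnj (\<i> ^ (a' + b')) * \<i> ^ (a + b) *
    complex_of_real (vilenkin_norm q a' b' c * vilenkin_norm q a b c *
      (vilenkin_sum q a' b' a b c / qfac q (Suc (a + b' + c)) * (2 / qlog_ratio q)))) {-1<..<1}"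
proof -
  have "((\<lambda>\<xi>. q powr (real a' - real a - 1) * (2 / (1 - \<xi>)\<^sup>2) *
       vilenkin_kernel q a' b' a b c (q powr (real a' - real a - 1) * eta_of \<xi>)) has_integral
     vilenkin_sum q a' b' a b c / qfac q (Suc (a + b' + c)) * (2 / qlog_ratio q)) {-1<..<1}"
    using assms by (intro has_integral_eta_of_scaled vilenkin_kernel_integrable vilenkin_kernel_has_integral) auto
  then have "((\<lambda>\<xi>. cnj (\<i> ^ (a' + b')) * \<i> ^ (a + b) *
    complex_of_real (vilenkin_norm q a' b' c * vilenkin_norm q a b c *
      (q powr (real a' - real a - 1) * (2 / (1 - \<xi>)\<^sup>2) *
       vilenkin_kernel q a' b' a b c (q powr (real a' - real a - 1) * eta_of \<xi>)))) has_integral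
    cnj (\<i> ^ (a' + b')) * \<i> ^ (a + b) *
    complex_of_real (vilenkin_norm q a' b' c * vilenkin_norm q a b c *
      (vilenkin_sum q a' b' a b c / qfac q (Suc (a + b' + c)) * (2 / qlog_ratio q)))) {-1<..<1}"
    by (intro has_integral_mult_right has_integral_of_real)
  then show ?thesis
    by (rule has_integral_eq[rotated]) (rule vilenkin_term_eq[OF assms, symmetric])
qed

section \<open>Normalisation and final evaluation\<close>

lemma qlog_ratio_inverse: "q > 0 \<Longrightarrow> qlog_ratio (inverse q) = qlog_ratio q"
proof -
  assume "q > 0"
  moreover have "(inverse q - q) / (- ln q) = (q - inverse q) / ln q"
    by (metis minus_diff_eq minus_divide_divide)
  ultimately show ?thesis by (simp add: qlog_ratio_def ln_inverse)
qed

lemma qlog_ratio_nonzero: "q > 0 \<Longrightarrow> qlog_ratio q \<noteq> 0"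
  using diff_inverse_nonzero[of q] by (auto simp: qlog_ratio_def)

text \<open>The value is the denominator in \<open>vilenkin_sum_diagonal\<close>, so on the diagonal
  only [a+b+c]! remains.\<close>

lemma vilenkin_norm_squared:
  assumes "q > 0"
  shows "vilenkin_norm q a b c * vilenkin_norm q a b c = qfac q a * qfac q b * (qfac q (a + c) * qfac q (b + c))"
proof -
  have pos: "qfac q n > 0" for n using assms by (rule qfac_pos)
  have "sqrt (qfac q (b + c) * qfac q (a + c) / (qfac q a * qfac q b)) *
      sqrt (qfac q (b + c) * qfac q (a + c) / (qfac q a * qfac q b)) = qfac q (b + c) * qfac q (a + c) / (qfac q a * qfac q b)"
    using pos by (intro real_sqrt_mult_self[THEN trans] abs_of_nonneg) (simp add: less_imp_le)
  moreover have "x * B * (x * B) = y * (B * B)" if "x * x = y" for x y B :: real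
    by (simp add: that[symmetric] mult_ac)
  ultimately have "vilenkin_norm q a b c * vilenkin_norm q a b c =
      qfac q (b + c) * qfac q (a + c) / (qfac q a * qfac q b) * ((qfac q a * qfac q b) * (qfac q a * qfac q b))"
    unfolding vilenkin_norm_def by blast
  also have "\<dots> = qfac q a * qfac q b * (qfac q (a + c) * qfac q (b + c))"
    using assms by simp
  finally show ?thesis .
qed

lemma vilenkin_term_sum_has_integral:
  assumes "q > 0" "J - M = real a" "J - N = real b" "J' - M = real a'" "J' - N = real b'"
    and "M + N = real c" "a \<le> b" "a' \<le> b'"
  shows "((\<lambda>\<xi>. vilenkin_term q J' J M N \<xi> + vilenkin_term (inverse q) J' J M N \<xi>) has_integral
    complex_of_real (4 / qlog_ratio q) *
      (if J' = J then complex_of_real (1 / qnum q (2 * J + 1)) else 0)) {-1<..<1}"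
    (is "(_ has_integral ?R) _")
proof -
  have iq: "inverse q > 0" using assms(1) by simp
  have "real (a + b') = real (a' + b)"
    using assms(2-5) by simp
  then have ab: "a + b' = a' + b"
    by (simp only: of_nat_eq_iff)
  define I where "I = (\<lambda>p. cnj (\<i> ^ (a' + b')) * \<i> ^ (a + b) *
    complex_of_real (vilenkin_norm p a' b' c * vilenkin_norm p a b c *
      (vilenkin_sum p a' b' a b c / qfac p (Suc (a + b' + c)) * (2 / qlog_ratio p))))"
  have "((\<lambda>\<xi>. vilenkin_term q J' J M N \<xi> + vilenkin_term (inverse q) J' J M N \<xi>) has_integral I q + I (inverse q)) {-1<..<1}"
    unfolding I_def
    by (intro has_integral_add vilenkin_term_has_integral[OF assms] vilenkin_term_has_integral[OF iq assms(2-)])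
  moreover have "I q + I (inverse q) = ?R"
  proof (cases "J' = J")
    case False
    then have "a \<noteq> a'" using assms(2,4) by auto
    then have "vilenkin_sum q a' b' a b c = 0" "vilenkin_sum (inverse q) a' b' a b c = 0"
      using vilenkin_sum_eq_0[OF assms(1)] vilenkin_sum_eq_0[OF iq] assms(7,8) ab by auto
    then show ?thesis using False by (simp add: I_def)
  next
    case True
    then have eq: "a' = a" "b' = b" using assms(2-5) by auto
    have "cnj (\<i> ^ (a + b)) * \<i> ^ (a + b) = (1 :: complex)"
      by (simp flip: power_mult_distrib)
    moreover have "vilenkin_sum q a b a b c = vilenkin_sum (inverse q) a b a b c"
      using vilenkin_sum_swap[OF assms(1), of a b a b c] by simp
    ultimately have "I q + I (inverse q) = complex_of_real (2 * (vilenkin_norm q a b c * vilenkin_norm q a b c *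
      (vilenkin_sum q a b a b c / qfac q (Suc (a + b + c)) * (2 / qlog_ratio q))))"
      unfolding I_def eq using assms(1) by (simp add: vilenkin_norm_inverse qfac_inverse qlog_ratio_inverse)
    also have "2 * (vilenkin_norm q a b c * vilenkin_norm q a b c *
      (vilenkin_sum q a b a b c / qfac q (Suc (a + b + c)) * (2 / qlog_ratio q))) =
      4 / qlog_ratio q * (1 / qnum q (2 * J + 1))"
    proof -
      \<comment> \<open>As a + b + c = 2J, the remaining quotient [a+b+c]!/[a+b+c+1]! is 1/[2J+1].
        The constant 4 combines the two equal terms with the 2 of the moments.\<close>
      have "2 * J + 1 = real (Suc (a + b + c))" using assms by auto
      then have "qfac q (Suc (a + b + c)) = qfac q (a + b + c) * qnum q (2 * J + 1)"
        by (simp only: qfac_Suc)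
      then show ?thesis
        unfolding vilenkin_norm_squared[OF assms(1)] vilenkin_sum_diagonal[OF assms(1,7)]
        using assms(1) by (simp add: divide_simps)
    qed
    finally show ?thesis using True by simp
  qed
  ultimately show ?thesis by simp
qed

text \<open>The functions are evaluated at \<xi> and at a shifted point, for both \<open>q\<close>
  and \<open>inverse q\<close>; the shift stays in the open interval because it only rescales eta by
  a positive factor.\<close>

lemma vilenkin_term_cong:
  assumes "q > 0" "\<xi> \<in> {-1<..<1}"
    and "\<And>p \<zeta>. p > 0 \<Longrightarrow> \<zeta> \<in> {-1<..<1} \<Longrightarrow> vilenkin_P p J M N \<zeta> = vilenkin_P p J M0 N0 \<zeta>"
    and "\<And>p \<zeta>. p > 0 \<Longrightarrow> \<zeta> \<in> {-1<..<1} \<Longrightarrow> vilenkin_P p J' M N \<zeta> = vilenkin_P p J' M0 N0 \<zeta>"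
  shows "vilenkin_term q J' J M N \<xi> = vilenkin_term q J' J M0 N0 \<xi>"
proof -
  have "xi_of (q powr (- 2 * 1) * eta_of \<xi>) \<in> {-1<..<1}"
    using assms(1) eta_of_pos[OF assms(2)] by (intro xi_of_in) simp
  then show ?thesis
    unfolding vilenkin_term_def qshift_def using assms by simp
qed

lemma Ints_nonneg_imp_nat:
  assumes "x \<in> \<int>" "x \<ge> (0 :: real)"
  obtains n where "x = real n"
  using assms by (metis Ints_cases of_int_0_le_iff of_int_of_nat_eq zero_le_imp_eq_int)

theorem corollary4p2:
  fixes q J J' M N :: real
  assumes "q > 0"
    and "(\<forall>x \<in> {J, J', M, N}. x \<in> \<int>) \<or> (\<forall>x \<in> {J, J', M, N}. x - 1 / 2 \<in> \<int>)"
    and "\<bar>M\<bar> \<le> J" "\<bar>N\<bar> \<le> J" "\<bar>M\<bar> \<le> J'" "\<bar>N\<bar> \<le> J'"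
  shows
    "let F = (\<lambda>\<xi>::real.
           cnj (vilenkin_P (inverse q) J' M N \<xi>) *
             complex_of_real (1 / (q + inverse q - (q - inverse q) * \<xi>)) *
             qshift q 1 (vilenkin_P q J M N) \<xi>
         + cnj (vilenkin_P q J' M N \<xi>) *
             complex_of_real (1 / (q + inverse q + (q - inverse q) * \<xi>)) *
             qshift q (- 1) (vilenkin_P (inverse q) J M N) \<xi>)
     in F integrable_on {-1..1} \<and>
        complex_of_real (qlog_ratio q / 4) * integral {-1..1} F =
          (if J' = J then complex_of_real (1 / qnum q (2 * J + 1)) else 0)"
proof -
  have int: "x - y \<in> \<int>" "x + y \<in> \<int>" if xy: "x \<in> {J, J', M, N}" "y \<in> {J, J', M, N}" for x y
  proof -
    have "x - y \<in> \<int> \<and> x + y \<in> \<int>"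
    proof (cases "\<forall>x \<in> {J, J', M, N}. x \<in> \<int>")
      case True
      then show ?thesis using xy by (blast intro: Ints_diff Ints_add)
    next
      case False
      then have "x - 1 / 2 \<in> \<int>" "y - 1 / 2 \<in> \<int>" using xy assms(2) by blast+
      \<comment> \<open>The added 1 restores the two halves taken from x and y.\<close>
      then have "(x - 1 / 2) - (y - 1 / 2) \<in> \<int>" "(x - 1 / 2) + (y - 1 / 2) + 1 \<in> \<int>"
        by (blast intro: Ints_diff Ints_add Ints_1)+
      then show ?thesis by simp
    qed
    then show "x - y \<in> \<int>" "x + y \<in> \<int>" by auto
  qed
  \<comment> \<open>The pair (M0, N0) is the representative with N0 <= M0 and M0 + N0 >= 0 under the
    symmetries (M, N) to (N, M) and (M, N) to (-N, -M).\<close>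
  define M0 where "M0 = (if M + N \<ge> 0 then max M N else - min M N)"
  define N0 where "N0 = (if M + N \<ge> 0 then min M N else - max M N)"
  have abs: "\<bar>M0\<bar> \<le> J" "\<bar>N0\<bar> \<le> J" "\<bar>M0\<bar> \<le> J'" "\<bar>N0\<bar> \<le> J'" "N0 \<le> M0" "M0 + N0 \<ge> 0"
    using assms(3-6) by (auto simp: M0_def N0_def)
  have "K - M0 \<in> \<int>" "K - N0 \<in> \<int>" if "K \<in> {J, J'}" for K
    using that int[of K M] int[of K N] by (auto simp: M0_def N0_def min_def max_def)
  then obtain a b a' b' where
      "J - M0 = real a" "J - N0 = real b" "J' - M0 = real a'" "J' - N0 = real b'"
    using abs Ints_nonneg_imp_nat[of "J - M0"] Ints_nonneg_imp_nat[of "J - N0"]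
      Ints_nonneg_imp_nat[of "J' - M0"] Ints_nonneg_imp_nat[of "J' - N0"]
    by (metis abs_le_D1 diff_ge_0_iff_ge insertCI)
  moreover have "M0 + N0 = \<bar>M + N\<bar>" "\<bar>M + N\<bar> \<in> \<int>"
    using int[of M N] by (auto simp: M0_def N0_def)
  then obtain c where "M0 + N0 = real c"
    using Ints_nonneg_imp_nat[of "\<bar>M + N\<bar>"] by auto
  ultimately have nat: "J - M0 = real a" "J - N0 = real b" "J' - M0 = real a'" "J' - N0 = real b'"
      "M0 + N0 = real c" .
  have "real a \<le> real b" "real a' \<le> real b'"
    using nat abs(5) by linarith+
  then have le: "a \<le> b" "a' \<le> b'"
    by (simp_all only: of_nat_le_iff)
  have P: "vilenkin_P p K M N \<zeta> = vilenkin_P p K M0 N0 \<zeta>"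
    if "p > 0" "\<zeta> \<in> {-1<..<1}" "K \<in> {J, J'}" for p \<zeta> K
  proof -
    have neg: "vilenkin_P p K (- N0) (- M0) \<zeta> = vilenkin_P p K M0 N0 \<zeta>"
      using that nat le vilenkin_P_uminus[of p K M0 _ N0 _ c \<zeta>] by auto
    show ?thesis
      using neg vilenkin_P_commute[of p K M N \<zeta>] by (auto simp: M0_def N0_def min_def max_def split: if_splits)
  qed
  define F where "F = (\<lambda>\<xi>::real.
           cnj (vilenkin_P (inverse q) J' M N \<xi>) *
             complex_of_real (1 / (q + inverse q - (q - inverse q) * \<xi>)) *
             qshift q 1 (vilenkin_P q J M N) \<xi>
         + cnj (vilenkin_P q J' M N \<xi>) *
             complex_of_real (1 / (q + inverse q + (q - inverse q) * \<xi>)) *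
             qshift q (- 1) (vilenkin_P (inverse q) J M N) \<xi>)"
  define V where "V = (if J' = J then complex_of_real (1 / qnum q (2 * J + 1)) else 0)"
  have iq: "inverse q > 0" using assms(1) by simp
  \<comment> \<open>The backward shift for \<open>q\<close> is the forward shift for
    \<open>inverse q\<close>, so the second term of the integrand is the first with \<open>q\<close>
    inverted.\<close>
  have "q powr (- 2 * - 1) = inverse q powr (- 2 * 1)"
    using assms(1) by (simp add: powr_minus inverse_powr)
  then have sh: "qshift q (- 1) f \<xi> = qshift (inverse q) 1 f \<xi>" for f \<xi>
    by (simp only: qshift_def)
  have den: "q + inverse q + (q - inverse q) * \<xi> =
      inverse q + inverse (inverse q) - (inverse q - inverse (inverse q)) * \<xi>" for \<xi>
    by (simp add: algebra_simps)
  have F: "F \<xi> = vilenkin_term q J' J M N \<xi> + vilenkin_term (inverse q) J' J M N \<xi>" for \<xi>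
    unfolding F_def vilenkin_term_def sh den by simp
  have "((\<lambda>\<xi>. vilenkin_term q J' J M0 N0 \<xi> + vilenkin_term (inverse q) J' J M0 N0 \<xi>) has_integral
    complex_of_real (4 / qlog_ratio q) * V) {-1<..<1}"
    unfolding V_def by (rule vilenkin_term_sum_has_integral[OF assms(1) nat le])
  then have "(F has_integral complex_of_real (4 / qlog_ratio q) * V) {-1<..<1}"
  proof (rule has_integral_eq[rotated])
    fix \<xi> :: real assume \<xi>: "\<xi> \<in> {-1<..<1}"
    show "vilenkin_term q J' J M0 N0 \<xi> + vilenkin_term (inverse q) J' J M0 N0 \<xi> = F \<xi>"
      unfolding F
      using vilenkin_term_cong[OF assms(1) \<xi>, of J M N M0 N0 J'] vilenkin_term_cong[OF iq \<xi>, of J M N M0 N0 J'] P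
      by simp
  qed
  \<comment> \<open>The endpoints form a null set, so the value of \<open>eta_of\<close> at 1, where
    it divides by zero, does not affect the integral.\<close>
  then have "(F has_integral complex_of_real (4 / qlog_ratio q) * V) {-1..1}"
    using has_integral_open_interval[of F _ "-1" 1] by simp
  then have "F integrable_on {-1..1}" "complex_of_real (qlog_ratio q / 4) * integral {-1..1} F = V"
    using qlog_ratio_nonzero[OF assms(1)] by (auto simp: integral_unique has_integral_integrable)
  then show ?thesis
    unfolding F_def V_def Let_def by blast
qed

end
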